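(* Let $G=(A,B,E)$, $(w_e)_{e\in E}$, $(p_v)_{v\in A}$ and the order $v_1,\dots,v_{|A|}$ be an instance of the online bipartite stochastic matching problem under vertex arrivals, let $\mathbf{x}$ be an optimal solution of the linear program (LP-V), and let $M$ be the matching output by the Vertex Rounding Procedure run with $\mathbf{x}$. Then $$\mathbb{E}\Big[\sum_{e\in M} w_e\Big] \;=\; \sum_{v_t\in A}\mathbb{E}[\mathcal{WM}(v_t)] \;\ge\; (1-1/e)\cdot \mathrm{OPT},$$ where $\mathcal{WM}(v_t)$ is the weight of the edge of $M$ incident to $v_t$ (and $0$ if $v_t$ is unmatched).
   Context: Problem (vertex arrivals). We are given a bipartite graph $G=(A,B,E)$, non-negative edge weights $w_e$, a probability $p_v\in[0,1]$ for each $v\in A$, and a fixed order $v_1,\dots,v_{|A|}$ of $A$; write $p_t=p_{v_t}$. Edges are written $(v,u)$ with $v\in A$, $u\in B$. Vertices of $B$ are present from the start; at time $t$ the vertex $v_t$ is realized (arrives) with probability $p_t$, independently of everything else. If it arrives, an online algorithm must irrevocably either match it to a currently unmatched neighbor or leave it unmatched forever; if it does not arrive, nothing happens. An online algorithm knows $G,w,p$ and the order, may use unlimited computation and randomness, but its decision at time $t$ may depend only on the realizations of $v_1,\dots,v_t$ (and its own randomness). $\mathrm{OPT}$ denotes the maximum, over all online algorithms, of the expected total weight of the matching produced. For edges $e,e'$ sharing an endpoint $u\in B$, write $e'<e$ if the $A$-endpoint of $e'$ arrives earlier in the order than that of $e$. LP-V: maximize $\sum_{e\in E} w_e x_e$ subject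 to $\sum_{e\ni v}x_e\le p_v$ for all $v\in A$; $\sum_{e\ni u}x_e\le 1$ for all $u\in B$; $p_v\big(1-\sum_{e'\ni u,\,e'<e}x_{e'}\big)\ge x_e$ for all $e=(v,u)\in E$; $x_e\ge 0$ for all $e$. Vertex Rounding Procedure (input: a solution $\mathbf{x}$ of LP-V). Start with $M=\emptyset$. For $t=1,\dots,|A|$: let $v=v_t$; for each neighbor $u$ of $v$ set $\alpha_{t,u}=\sum_{e\ni u,\,e<(v,u)}x_e$; let $P=\emptyset$; for each neighbor $u$ of $v$ that is unmatched in $M$ and has $x_{(v,u)}>0$, independently add $(v,u)$ to $P$ with probability $\frac{x_{(v,u)}}{p_v(1-\alpha_{t,u})}$; if $P\neq\emptyset$ and $v_t$ is realized, add to $M$ an edge of $P$ of maximum weight. Output $M$. *)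

theory Defs
  imports "HOL-Probability.Probability"
begin

text \<open>
  The two sides of the bipartite graph live in different types, so an edge is a pair \<open>(v, u)\<close> with
  \<open>v \<in> A\<close>, \<open>u \<in> B\<close>. The list \<open>vs\<close> is the arrival order; \<open>vs ! t\<close> is the vertex arriving at time
  \<open>t\<close>, and times start at 0.
\<close>

definition vertex_arrival_instance ::
  "'a set \<Rightarrow> 'b set \<Rightarrow> ('a \<times> 'b) set \<Rightarrow> ('a \<times> 'b \<Rightarrow> real) \<Rightarrow> ('a \<Rightarrow> real) \<Rightarrow> 'a list \<Rightarrow> bool" where
  "vertex_arrival_instance A B E w p vs \<longleftrightarrow>
     finite A \<and> finite B \<and> E \<subseteq> A \<times> B \<and>
     (\<forall>e\<in>E. 0 \<le> w e) \<and> (\<forall>v\<in>A. 0 \<le> p v \<and> p v \<le> 1) \<and>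
     distinct vs \<and> set vs = A"

definition edge_before :: "'a list \<Rightarrow> 'a \<times> 'b \<Rightarrow> 'a \<times> 'b \<Rightarrow> bool" where
  "edge_before vs e' e \<longleftrightarrow>
     snd e' = snd e \<and> (\<exists>i j. i < j \<and> j < length vs \<and> fst e' = vs ! i \<and> fst e = vs ! j)"

definition alpha :: "('a \<times> 'b) set \<Rightarrow> 'a list \<Rightarrow> ('a \<times> 'b \<Rightarrow> real) \<Rightarrow> 'a \<times> 'b \<Rightarrow> real" where
  "alpha E vs x e = (\<Sum>e' \<in> {e' \<in> E. edge_before vs e' e}. x e')"

definition LP_V_feasible ::
  "'a set \<Rightarrow> 'b set \<Rightarrow> ('a \<times> 'b) set \<Rightarrow> ('a \<Rightarrow> real) \<Rightarrow> 'a list \<Rightarrow> ('a \<times> 'b \<Rightarrow> real) \<Rightarrow> bool" where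
  "LP_V_feasible A B E p vs x \<longleftrightarrow>
     (\<forall>v\<in>A. (\<Sum>e \<in> {e \<in> E. fst e = v}. x e) \<le> p v) \<and>
     (\<forall>u\<in>B. (\<Sum>e \<in> {e \<in> E. snd e = u}. x e) \<le> 1) \<and>
     (\<forall>e\<in>E. p (fst e) * (1 - alpha E vs x e) \<ge> x e) \<and>
     (\<forall>e\<in>E. x e \<ge> 0)"

definition LP_V_optimal ::
  "'a set \<Rightarrow> 'b set \<Rightarrow> ('a \<times> 'b) set \<Rightarrow> ('a \<times> 'b \<Rightarrow> real) \<Rightarrow> ('a \<Rightarrow> real) \<Rightarrow> 'a list
     \<Rightarrow> ('a \<times> 'b \<Rightarrow> real) \<Rightarrow> bool" where
  "LP_V_optimal A B E w p vs x \<longleftrightarrow>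
     LP_V_feasible A B E p vs x \<and>
     (\<forall>y. LP_V_feasible A B E p vs y \<longrightarrow> (\<Sum>e\<in>E. w e * y e) \<le> (\<Sum>e\<in>E. w e * x e))"

text \<open>
  The procedure adds to \<open>M\<close> some edge of maximum weight in \<open>P\<close> without fixing how ties are broken.
  The tie-breaking rule is therefore a parameter, possibly randomized and dependent on the current
  matching \<open>M\<close>.
\<close>

definition max_weight_rule ::
  "('a \<times> 'b) set \<Rightarrow> ('a \<times> 'b \<Rightarrow> real)
     \<Rightarrow> (('a \<times> 'b) set \<Rightarrow> ('a \<times> 'b) set \<Rightarrow> ('a \<times> 'b) pmf) \<Rightarrow> bool" where
  "max_weight_rule E w pick \<longleftrightarrow>
     (\<forall>M P. P \<subseteq> E \<and> P \<noteq> {} \<longrightarrow> set_pmf (pick M P) \<subseteq> {e \<in> P. \<forall>e'\<in>P. w e' \<le> w e})"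

definition proposals ::
  "('a \<times> 'b) set \<Rightarrow> ('a \<Rightarrow> real) \<Rightarrow> 'a list \<Rightarrow> ('a \<times> 'b \<Rightarrow> real) \<Rightarrow> 'a \<Rightarrow> ('a \<times> 'b) set
     \<Rightarrow> ('a \<times> 'b) set pmf" where
  "proposals E p vs x v M =
     (let C = {e \<in> E. fst e = v \<and> snd e \<notin> snd ` M \<and> x e > 0} in
      map_pmf (\<lambda>f. {e \<in> C. f e})
        (Pi_pmf C False (\<lambda>e. bernoulli_pmf (x e / (p v * (1 - alpha E vs x e))))))"

definition rounding_step ::
  "('a \<times> 'b) set \<Rightarrow> ('a \<Rightarrow> real) \<Rightarrow> 'a list \<Rightarrow> ('a \<times> 'b \<Rightarrow> real)
     \<Rightarrow> (('a \<times> 'b) set \<Rightarrow> ('a \<times> 'b) set \<Rightarrow> ('a \<times> 'b) pmf)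
     \<Rightarrow> 'a \<Rightarrow> ('a \<times> 'b) set \<Rightarrow> ('a \<times> 'b) set pmf" where
  "rounding_step E p vs x pick v M =
     do {
       P \<leftarrow> proposals E p vs x v M;
       realized \<leftarrow> bernoulli_pmf (p v);
       if P \<noteq> {} \<and> realized
       then map_pmf (\<lambda>e. insert e M) (pick M P)
       else return_pmf M
     }"

definition vertex_rounding ::
  "('a \<times> 'b) set \<Rightarrow> ('a \<Rightarrow> real) \<Rightarrow> 'a list \<Rightarrow> ('a \<times> 'b \<Rightarrow> real)
     \<Rightarrow> (('a \<times> 'b) set \<Rightarrow> ('a \<times> 'b) set \<Rightarrow> ('a \<times> 'b) pmf) \<Rightarrow> ('a \<times> 'b) set pmf" where
  "vertex_rounding E p vs x pick =
     foldl (\<lambda>\<mu> v. bind_pmf \<mu> (rounding_step E p vs x pick v)) (return_pmf {}) vs"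

definition WM :: "('a \<times> 'b \<Rightarrow> real) \<Rightarrow> ('a \<times> 'b) set \<Rightarrow> 'a \<Rightarrow> real" where
  "WM w M v = (if \<exists>u. (v, u) \<in> M then w (THE e. e \<in> M \<and> fst e = v) else 0)"

definition realizations :: "('a \<Rightarrow> real) \<Rightarrow> 'a list \<Rightarrow> (nat \<Rightarrow> bool) pmf" where
  "realizations p vs = Pi_pmf {..<length vs} False (\<lambda>t. bernoulli_pmf (p (vs ! t)))"

text \<open>
  Once its random seed is fixed, an online algorithm is a function \<open>d\<close> from the realizations
  observed so far to a decision: on arrival of \<open>vs ! t\<close> it is given the list of the realizations at
  times \<open>0, \<dots>, t\<close> and answers \<open>Some u\<close> (match to \<open>u\<close>) or \<open>None\<close> (leave unmatched forever). The
  answer is ignored if \<open>vs ! t\<close> is not realized.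
\<close>

definition algo_matching ::
  "'a list \<Rightarrow> (bool list \<Rightarrow> 'b option) \<Rightarrow> (nat \<Rightarrow> bool) \<Rightarrow> nat \<Rightarrow> ('a \<times> 'b) set" where
  "algo_matching vs d r t =
     {(vs ! s, u) | s u. s < t \<and> r s \<and> d (map r [0..<Suc s]) = Some u}"

definition valid_algo :: "('a \<times> 'b) set \<Rightarrow> 'a list \<Rightarrow> (bool list \<Rightarrow> 'b option) \<Rightarrow> bool" where
  "valid_algo E vs d \<longleftrightarrow>
     (\<forall>r t u. t < length vs \<and> r t \<and> d (map r [0..<Suc t]) = Some u \<longrightarrow>
        (vs ! t, u) \<in> E \<and> u \<notin> snd ` algo_matching vs d r t)"

text \<open>
  A randomized online algorithm draws its seed independently of the realizations, which amounts to
  drawing a deterministic online algorithm. Discrete distributions lose no generality: up to time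
  \<open>length vs\<close> there are only finitely many different valid deterministic algorithms.
\<close>

definition online_algos :: "('a \<times> 'b) set \<Rightarrow> 'a list \<Rightarrow> (bool list \<Rightarrow> 'b option) pmf set" where
  "online_algos E vs = {D. \<forall>d \<in> set_pmf D. valid_algo E vs d}"

definition algo_value ::
  "('a \<times> 'b \<Rightarrow> real) \<Rightarrow> ('a \<Rightarrow> real) \<Rightarrow> 'a list \<Rightarrow> (bool list \<Rightarrow> 'b option) pmf \<Rightarrow> real" where
  "algo_value w p vs D =
     measure_pmf.expectation (pair_pmf D (realizations p vs))
       (\<lambda>(d, r). \<Sum>e \<in> algo_matching vs d r (length vs). w e)"

definition OPT ::
  "('a \<times> 'b) set \<Rightarrow> ('a \<times> 'b \<Rightarrow> real) \<Rightarrow> ('a \<Rightarrow> real) \<Rightarrow> 'a list \<Rightarrow> real" where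
  "OPT E w p vs = (SUP D \<in> online_algos E vs. algo_value w p vs D)"

lemma algo_matching_subset:
  assumes "valid_algo E vs d"
  shows "algo_matching vs d r (length vs) \<subseteq> E"
proof
  fix e assume "e \<in> algo_matching vs d r (length vs)"
  then obtain s u where "e = (vs ! s, u)" "s < length vs" "r s" "d (map r [0..<Suc s]) = Some u"
    unfolding algo_matching_def by blast
  with assms show "e \<in> E"
    unfolding valid_algo_def by metis
qed

text \<open>The supremum defining \<open>OPT\<close> is a maximum.\<close>

lemma OPT_is_maximum:
  fixes E :: "('a \<times> 'b) set"
  assumes inst: "vertex_arrival_instance A B E w p vs"
  shows "\<exists>D \<in> online_algos E vs. algo_value w p vs D = OPT E w p vs"
    and "\<And>D. D \<in> online_algos E vs \<Longrightarrow> algo_value w p vs D \<le> OPT E w p vs"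
proof -
  have finE: "finite E"
    using inst unfolding vertex_arrival_instance_def by (meson finite_SigmaI finite_subset)
  have w0: "\<And>e. e \<in> E \<Longrightarrow> 0 \<le> w e"
    using inst unfolding vertex_arrival_instance_def by blast
  define R where "R = realizations p vs"
  define V where "V = {d :: bool list \<Rightarrow> 'b option. valid_algo E vs d}"
  define h where "h = (\<lambda>d r. \<Sum>e \<in> algo_matching vs d r (length vs). w e)"
  define g where "g = (\<lambda>d. measure_pmf.expectation R (h d))"
  have finR: "finite (set_pmf R)"
    unfolding R_def realizations_def by (simp add: set_Pi_pmf finite_PiE_dflt)
  have hb: "0 \<le> h d r" "h d r \<le> sum w E" if "d \<in> V" for d r
  proof -
    have "algo_matching vs d r (length vs) \<subseteq> E"
      using that algo_matching_subset unfolding V_def by blast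
    then show "0 \<le> h d r" "h d r \<le> sum w E"
      unfolding h_def using w0 finE by (auto intro!: sum_nonneg sum_mono2)
  qed
  have "(\<lambda>_. None) \<in> V"
    unfolding V_def valid_algo_def by simp
  then have Vne: "V \<noteq> {}" by blast
  have "finite (g ` V)"
  proof -
    define F where "F = (\<lambda>m. \<Sum>r\<in>set_pmf R. pmf R r * sum w (m r))"
    define m where "m = (\<lambda>d :: bool list \<Rightarrow> 'b option.
      restrict (\<lambda>r. algo_matching vs d r (length vs)) (set_pmf R))"
    have gF: "g d = F (m d)" for d
      unfolding g_def h_def F_def m_def
      by (subst integral_measure_pmf_real[OF finR]) (auto simp: mult.commute intro!: sum.cong)
    have m: "m d \<in> set_pmf R \<rightarrow>\<^sub>E Pow E" if "d \<in> V" for d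
      using that algo_matching_subset[of E vs d] unfolding V_def m_def
      by (simp add: restrict_PiE_iff)
    have "g ` V \<subseteq> F ` (set_pmf R \<rightarrow>\<^sub>E Pow E)"
      using gF m by (intro image_subsetI) (simp add: image_eqI)
    moreover have "finite (set_pmf R \<rightarrow>\<^sub>E Pow E)"
      using finR finE by (intro finite_PiE) auto
    ultimately show ?thesis by (meson finite_imageI finite_subset)
  qed
  then have "Max (g ` V) \<in> g ` V" "\<And>d. d \<in> V \<Longrightarrow> g d \<le> Max (g ` V)"
    using Vne by simp_all
  then obtain d0 where d0: "d0 \<in> V" "\<And>d. d \<in> V \<Longrightarrow> g d \<le> g d0"
    by (elim imageE) simp
  have le: "algo_value w p vs D \<le> g d0" if D: "D \<in> online_algos E vs" for D
  proof -
    have DV: "d \<in> V" if "d \<in> set_pmf D" for d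
      using D that unfolding online_algos_def V_def by blast
    have g: "(\<integral>\<^sup>+r. ennreal (h d r) \<partial>R) = ennreal (g d)" if "d \<in> V" for d
      unfolding g_def using hb(1)[OF that] finR
      by (intro nn_integral_eq_integral integrable_measure_pmf_finite) auto
    have g0: "0 \<le> g d0"
      unfolding g_def using hb(1)[OF d0(1)] by simp
    have "algo_value w p vs D = enn2real (\<integral>\<^sup>+z. ennreal (h (fst z) (snd z)) \<partial>pair_pmf D R)"
      unfolding algo_value_def R_def[symmetric] case_prod_unfold h_def[symmetric] using hb(1) DV
      by (intro integral_eq_nn_integral) (auto simp: AE_measure_pmf_iff)
    moreover have "(\<integral>\<^sup>+z. ennreal (h (fst z) (snd z)) \<partial>pair_pmf D R)
        = (\<integral>\<^sup>+d. \<integral>\<^sup>+r. ennreal (h d r) \<partial>R \<partial>D)"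
      by (simp add: nn_integral_pair_pmf')
    moreover have "\<dots> \<le> (\<integral>\<^sup>+d. ennreal (g d0) \<partial>D)"
      using DV d0(2) g by (intro nn_integral_mono_AE) (auto simp: AE_measure_pmf_iff ennreal_leI)
    ultimately show ?thesis
      using g0 by (simp add: enn2real_leI)
  qed
  have at: "return_pmf d0 \<in> online_algos E vs"
    using d0 unfolding online_algos_def V_def by simp
  have val0: "algo_value w p vs (return_pmf d0) = g d0"
    unfolding algo_value_def g_def h_def R_def by (simp add: pair_return_pmf1)
  have OPT: "OPT E w p vs = g d0"
    unfolding OPT_def
  proof (rule cSup_eq_maximum)
    show "g d0 \<in> algo_value w p vs ` online_algos E vs"
      using imageI[OF at, of "algo_value w p vs"] unfolding val0 .
    show "y \<le> g d0" if "y \<in> algo_value w p vs ` online_algos E vs" for y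
      using that le by (elim imageE) simp
  qed
  show "\<exists>D \<in> online_algos E vs. algo_value w p vs D = OPT E w p vs"
    unfolding OPT using at val0 by (rule bexI[rotated])
  show "algo_value w p vs D \<le> OPT E w p vs" if "D \<in> online_algos E vs" for D
    unfolding OPT using that by (rule le)
qed

end

theory Submission imports Defs begin

text \<open>
  The rounding gains at least \<open>1 - 1/e\<close> times the LP value of each arriving vertex \<open>v\<close>. Say that
  \<open>u\<close> proposes with probability \<open>q u = x (v, u) / (p v * (1 - alpha u))\<close> when it is free. At most
  one vertex of \<open>B\<close> is taken in a step, a free \<open>u\<close> with probability at most \<open>p v * q u\<close>, and this
  makes the free vertices negatively dependent in the following sense: for all \<open>c u \<in> [0, 1]\<close>,
  the expectation of the product of the \<open>1 - c u * [u is free]\<close> is at most the product of the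
  \<open>1 - c u * (1 - alpha u)\<close>. The induction step replaces \<open>c u\<close> by \<open>c u * (1 - p v * q u)\<close>. For
  \<open>c = q\<close> this bounds the probability that no edge of weight at least \<open>\<theta>\<close> is proposed by the
  product of the \<open>1 - x (v, u) / p v\<close>, hence by \<open>exp (- s)\<close> where \<open>s \<le> 1\<close> is the sum of the
  \<open>x (v, u) / p v\<close>. Concavity of \<open>1 - exp (- s)\<close> and summation over the thresholds \<open>\<theta>\<close> give
  the bound for \<open>v\<close>. Conversely, the matching probabilities of an online algorithm form a feasible
  solution of the LP, because the set of vertices still free before time \<open>t\<close> is independent of
  the arrival at time \<open>t\<close>.
\<close>

section \<open>Preliminaries\<close>

lemma expectation_bind_finite:
  fixes h :: "'b \<Rightarrow> real"
  assumes "finite (set_pmf M)" "\<And>x. x \<in> set_pmf M \<Longrightarrow> finite (set_pmf (K x))"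
  shows "measure_pmf.expectation (bind_pmf M K) h
           = measure_pmf.expectation M (\<lambda>x. measure_pmf.expectation (K x) h)"
proof -
  have "measure_pmf.expectation M (\<lambda>x. measure_pmf.expectation (K x) h)
      = (\<Sum>x\<in>set_pmf M. pmf M x *\<^sub>R measure_pmf.expectation (K x) h)"
    by (rule integral_measure_pmf[OF assms(1)]) (simp add: set_pmf_iff)
  then show ?thesis by (simp add: pmf_expectation_bind[OF assms order_refl])
qed

lemma integrable_finite_pmf:
  fixes f :: "'b \<Rightarrow> real"
  shows "finite (set_pmf M) \<Longrightarrow> integrable (measure_pmf M) f"
  by (rule integrable_measure_pmf_finite)

lemma expectation_add_const_sum:
  fixes f :: "'c \<Rightarrow> 'b \<Rightarrow> real"
  assumes "finite (set_pmf M)"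
  shows "measure_pmf.expectation M (\<lambda>x. a + (\<Sum>i\<in>I. b i * f i x))
    = a + (\<Sum>i\<in>I. b i * measure_pmf.expectation M (f i))"
proof -
  note int = integrable_finite_pmf[OF assms]
  have "measure_pmf.expectation M (\<lambda>x. a + (\<Sum>i\<in>I. b i * f i x))
      = a + measure_pmf.expectation M (\<lambda>x. \<Sum>i\<in>I. b i * f i x)"
    by (subst Bochner_Integration.integral_add[OF int int]) simp
  also have "measure_pmf.expectation M (\<lambda>x. \<Sum>i\<in>I. b i * f i x)
      = (\<Sum>i\<in>I. measure_pmf.expectation M (\<lambda>x. b i * f i x))"
    by (rule Bochner_Integration.integral_sum[OF int])
  finally show ?thesis by simp
qed

lemma expectation_one_minus:
  fixes f :: "'b \<Rightarrow> real"
  assumes "finite (set_pmf M)"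
  shows "measure_pmf.expectation M (\<lambda>x. 1 - f x) = 1 - measure_pmf.expectation M f"
  by (subst Bochner_Integration.integral_diff) (simp_all add: integrable_finite_pmf[OF assms])

lemma expectation_mono_finite:
  fixes f g :: "'b \<Rightarrow> real"
  assumes "finite (set_pmf M)" "\<And>x. x \<in> set_pmf M \<Longrightarrow> f x \<le> g x"
  shows "measure_pmf.expectation M f \<le> measure_pmf.expectation M g"
  using assms by (intro integral_mono_AE integrable_measure_pmf_finite) (auto simp: AE_measure_pmf_iff)

lemma expectation_cong_pmf:
  fixes f g :: "'b \<Rightarrow> real"
  assumes "\<And>x. x \<in> set_pmf M \<Longrightarrow> f x = g x"
  shows "measure_pmf.expectation M f = measure_pmf.expectation M g"
  using assms by (intro integral_cong_AE) (auto simp: AE_measure_pmf_iff)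

lemma expectation_of_bool:
  "measure_pmf.expectation M (\<lambda>x. of_bool (Q x)) = measure_pmf.prob M {x. Q x}"
proof -
  have "(\<lambda>x. of_bool (Q x) :: real) = indicator {x. Q x}"
    by (auto simp: indicator_def)
  then show ?thesis by simp
qed

text \<open>Expanding the right-hand product in the \<open>b u\<close>, the left side consists of
  the terms of degree zero and one. All other terms are non-negative, since \<open>1 - c u\<close>
  and \<open>b u\<close> are.\<close>

lemma prod_one_minus_flip_le:
  fixes c b :: "'b \<Rightarrow> real"
  assumes "finite T" "\<And>u. u \<in> T \<Longrightarrow> c u \<le> 1" "\<And>u. u \<in> T \<Longrightarrow> 0 \<le> b u"
  shows "(\<Prod>u\<in>T. 1 - c u) + (\<Sum>u\<in>T. b u * (\<Prod>u'\<in>T - {u}. 1 - c u')) \<le> (\<Prod>u\<in>T. 1 - c u + b u)"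
  using assms
proof (induction T rule: finite_induct)
  case empty then show ?case by simp
next
  case (insert a T)
  let ?S = "\<Sum>u\<in>T. b u * (\<Prod>u'\<in>T - {u}. 1 - c u')"
  have "(\<Sum>u\<in>T. b u * (\<Prod>u'\<in>insert a T - {u}. 1 - c u')) = (1 - c a) * ?S"
    unfolding sum_distrib_left
  proof (rule sum.cong[OF refl])
    fix u assume u: "u \<in> T"
    then have "insert a T - {u} = insert a (T - {u})" using insert.hyps by auto
    then show "b u * (\<Prod>u'\<in>insert a T - {u}. 1 - c u') = (1 - c a) * (b u * (\<Prod>u'\<in>T - {u}. 1 - c u'))"
      using insert.hyps by (simp add: algebra_simps)
  qed
  moreover have "insert a T - {a} = T" using insert.hyps by auto
  ultimately have "(\<Prod>u\<in>insert a T. 1 - c u) + (\<Sum>u\<in>insert a T. b u * (\<Prod>u'\<in>insert a T - {u}. 1 - c u'))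
     = (1 - c a + b a) * ((\<Prod>u\<in>T. 1 - c u) + ?S) - b a * ?S"
    using insert.hyps by (simp add: algebra_simps)
  also have "0 \<le> ?S"
    using insert.prems by (intro sum_nonneg mult_nonneg_nonneg prod_nonneg) auto
  then have "(1 - c a + b a) * ((\<Prod>u\<in>T. 1 - c u) + ?S) - b a * ?S \<le> (1 - c a + b a) * ((\<Prod>u\<in>T. 1 - c u) + ?S)"
    using insert.prems by simp
  also have "\<dots> \<le> (1 - c a + b a) * (\<Prod>u\<in>T. 1 - c u + b u)"
  proof (rule mult_left_mono[OF insert.IH])
    show "0 \<le> 1 - c a + b a" using insert.prems(1)[of a] insert.prems(2)[of a] by simp
  qed (use insert.prems in auto)
  finally show ?case using insert.hyps by simp
qed

text \<open>\<open>l\<close> consists of the increments between consecutive elements of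
  \<open>W\<close>, starting from \<open>0\<close>. It turns a bound for every threshold event
  "weight at least \<theta>" into a bound for the weight itself.\<close>

lemma layer_decomposition:
  fixes W :: "real set"
  assumes "finite W" "\<And>y. y \<in> W \<Longrightarrow> 0 \<le> y"
  shows "\<exists>l. (\<forall>\<theta>\<in>W. 0 \<le> l \<theta>) \<and> (\<forall>y\<in>W. y = (\<Sum>\<theta>\<in>{\<theta>\<in>W. \<theta> \<le> y}. l \<theta>))"
  using assms
proof (induction W rule: finite_linorder_max_induct)
  case empty then show ?case by simp
next
  case (insert b W)
  then obtain l where l: "\<forall>\<theta>\<in>W. 0 \<le> l \<theta>" "\<And>y. y \<in> W \<Longrightarrow> y = (\<Sum>\<theta>\<in>{\<theta>\<in>W. \<theta> \<le> y}. l \<theta>)"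
    by (metis insertCI)
  \<comment> \<open>The increments up to the old maximum telescope to that maximum, so the new
    increment \<open>b - sum l W\<close> is non-negative.\<close>
  have "(\<Sum>\<theta>\<in>W. l \<theta>) \<le> b"
  proof (cases "W = {}")
    case False
    then have m: "Max W \<in> W" using insert.hyps by simp
    have "{\<theta>\<in>W. \<theta> \<le> Max W} = W" using insert.hyps by auto
    with l(2)[OF m] insert.hyps m show ?thesis by force
  qed (use insert.prems in simp)
  moreover have "b \<notin> W" using insert.hyps by auto
  define l' where "l' = l(b := b - (\<Sum>\<theta>\<in>W. l \<theta>))"
  have "y = (\<Sum>\<theta>\<in>{\<theta>\<in>insert b W. \<theta> \<le> y}. l' \<theta>)" if "y \<in> insert b W" for y
  proof (cases "y = b")
    case True
    have "{\<theta>\<in>insert b W. \<theta> \<le> b} = insert b W" using insert.hyps by auto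
    moreover have "sum l' W = sum l W"
      using \<open>b \<notin> W\<close> by (intro sum.cong) (auto simp: l'_def)
    ultimately show ?thesis using True \<open>b \<notin> W\<close> insert.hyps by (simp add: l'_def)
  next
    case False
    then have "y \<in> W" "y < b" using that insert.hyps by auto
    then have "{\<theta>\<in>insert b W. \<theta> \<le> y} = {\<theta>\<in>W. \<theta> \<le> y}" by auto
    moreover have "sum l' {\<theta>\<in>W. \<theta> \<le> y} = sum l {\<theta>\<in>W. \<theta> \<le> y}"
      using \<open>b \<notin> W\<close> by (intro sum.cong) (auto simp: l'_def)
    ultimately show ?thesis using l(2)[OF \<open>y \<in> W\<close>] by simp
  qed
  moreover have "\<forall>\<theta>\<in>insert b W. 0 \<le> l' \<theta>"
    using l(1) \<open>(\<Sum>\<theta>\<in>W. l \<theta>) \<le> b\<close> by (auto simp: l'_def)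
  ultimately show ?case by blast
qed

text \<open>The constant of the theorem is the value of \<open>1 - exp (- s)\<close> at
  \<open>s = 1\<close>; by concavity the function lies above its chord from \<open>0\<close> to
  \<open>1\<close>.\<close>

lemma one_minus_exp_ge_chord:
  fixes s :: real
  assumes "0 \<le> s" "s \<le> 1"
  shows "(1 - 1 / exp 1) * s \<le> 1 - exp (- s)"
proof -
  have "exp ((1 - s) * 0 + s * (-1)) \<le> (1 - s) * exp 0 + s * exp (-1::real)"
    using convex_onD[OF exp_convex, of s 0 "-1"] assms by (simp add: algebra_simps)
  then show ?thesis by (simp add: algebra_simps exp_minus divide_inverse)
qed

lemma prod_one_minus_le_exp:
  fixes y :: "'b \<Rightarrow> real"
  assumes "\<And>u. u \<in> S \<Longrightarrow> y u \<le> 1"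
  shows "(\<Prod>u\<in>S. 1 - y u) \<le> exp (- (\<Sum>u\<in>S. y u))"
proof (cases "finite S")
  case True
  have "(\<Prod>u\<in>S. 1 - y u) \<le> (\<Prod>u\<in>S. exp (- y u))"
  proof (rule prod_mono)
    fix u assume "u \<in> S"
    then show "0 \<le> 1 - y u \<and> 1 - y u \<le> exp (- y u)"
      using assms[of u] exp_ge_add_one_self[of "- y u"] by simp
  qed
  then show ?thesis using True by (simp add: exp_sum sum_negf[symmetric])
qed simp

section \<open>The rounding procedure\<close>

locale vertex_arrival_rounding =
  fixes A :: "'a set" and B :: "'b set" and E :: "('a \<times> 'b) set"
    and w :: "'a \<times> 'b \<Rightarrow> real" and p :: "'a \<Rightarrow> real" and vs :: "'a list"
    and x :: "'a \<times> 'b \<Rightarrow> real"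
    and pick :: "('a \<times> 'b) set \<Rightarrow> ('a \<times> 'b) set \<Rightarrow> ('a \<times> 'b) pmf"
  assumes inst: "vertex_arrival_instance A B E w p vs"
    and feasible: "LP_V_feasible A B E p vs x"
    and rule: "max_weight_rule E w pick"
begin

section \<open>Loads and proposal probabilities\<close>

lemma finite_E: "finite E"
  using inst unfolding vertex_arrival_instance_def by (meson finite_SigmaI finite_subset)

lemma edge_ends: "(v, u) \<in> E \<Longrightarrow> v \<in> A" "(v, u) \<in> E \<Longrightarrow> u \<in> B"
  and weight_nonneg: "e \<in> E \<Longrightarrow> 0 \<le> w e"
  and p_bounds: "v \<in> A \<Longrightarrow> 0 \<le> p v" "v \<in> A \<Longrightarrow> p v \<le> 1"
  and set_vs: "set vs = A" and distinct_vs: "distinct vs"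
  using inst unfolding vertex_arrival_instance_def by auto

lemma x_nonneg: "e \<in> E \<Longrightarrow> 0 \<le> x e"
  and x_le: "(v, u) \<in> E \<Longrightarrow> x (v, u) \<le> p v * (1 - alpha E vs x (v, u))"
  using feasible unfolding LP_V_feasible_def by auto

text \<open>A variant of \<open>alpha\<close> indexed by a prefix of the arrivals, which suits
  induction over prefixes and makes sense for non-neighbours too. \<open>1 - load us u\<close> will
  turn out to be a lower bound for the probability that \<open>u\<close> is free after
  \<open>us\<close>.\<close>

definition load :: "'a list \<Rightarrow> 'b \<Rightarrow> real" where
  "load us u = (\<Sum>e\<in>{e \<in> E. snd e = u \<and> fst e \<in> set us}. x e)"

text \<open>The LP does not constrain \<open>x\<close> outside \<open>E\<close>. Cutting it off
  there lets sums and products run over arbitrary sets of vertices \<open>u\<close>.\<close>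

definition flow :: "'a \<Rightarrow> 'b \<Rightarrow> real" where
  "flow v u = (if (v, u) \<in> E then x (v, u) else 0)"

definition prop_prob :: "'a list \<Rightarrow> 'a \<Rightarrow> 'b \<Rightarrow> real" where
  "prop_prob us v u = flow v u / (p v * (1 - load us u))"

lemma load_le_1: "load us u \<le> 1"
proof (cases "u \<in> B")
  case True
  have "load us u \<le> (\<Sum>e\<in>{e \<in> E. snd e = u}. x e)"
    unfolding load_def using finite_E x_nonneg by (intro sum_mono2) auto
  also have "\<dots> \<le> 1"
    using feasible True unfolding LP_V_feasible_def by blast
  finally show ?thesis .
next
  case False
  then have "{e \<in> E. snd e = u \<and> fst e \<in> set us} = {}" using edge_ends by auto
  then show ?thesis unfolding load_def by (simp only: sum.empty)
qed

lemma load_snoc: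
  assumes "v \<notin> set us"
  shows "load (us @ [v]) u = load us u + flow v u"
proof -
  have "{e \<in> E. snd e = u \<and> fst e \<in> set (us @ [v])}
      = {e \<in> E. snd e = u \<and> fst e \<in> set us} \<union> {e \<in> E. e = (v, u)}" by auto
  moreover have "{e \<in> E. snd e = u \<and> fst e \<in> set us} \<inter> {e \<in> E. e = (v, u)} = {}"
    using assms by auto
  moreover have "sum x {e \<in> E. e = (v, u)} = flow v u"
  proof (cases "(v, u) \<in> E")
    case True
    then have "{e \<in> E. e = (v, u)} = {(v, u)}" by auto
    then show ?thesis using True by (simp add: flow_def)
  next
    case False
    then have "sum x {e \<in> E. e = (v, u)} = 0" by (intro sum.neutral) auto
    then show ?thesis using False by (simp add: flow_def)
  qed
  ultimately show ?thesis
    unfolding load_def using finite_E by (simp add: sum.union_disjoint)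
qed

text \<open>As \<open>vs\<close> is distinct, \<open>v\<close> occurs only at position
  \<open>length us\<close>, so the vertices arriving before it are exactly those of
  \<open>us\<close>.\<close>

lemma alpha_eq_load:
  assumes "vs = us @ v # rest"
  shows "alpha E vs x (v, u) = load us u"
proof -
  have "edge_before vs e (v, u) \<longleftrightarrow> snd e = u \<and> fst e \<in> set us" for e :: "'a \<times> 'b"
  proof
    assume "edge_before vs e (v, u)"
    then obtain i j where ij: "snd e = u" "i < j" "j < length vs" "fst e = vs ! i" "vs ! j = v"
      unfolding edge_before_def by auto
    have "vs ! length us = v" "length us < length vs" unfolding assms by auto
    then have "j = length us"
      using ij(3,5) distinct_vs nth_eq_iff_index_eq by metis
    then have "vs ! i = us ! i" "i < length us" unfolding assms using ij(2) by (auto simp: nth_append)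
    then show "snd e = u \<and> fst e \<in> set us"
      using ij(1,4) by simp
  next
    assume e: "snd e = u \<and> fst e \<in> set us"
    then obtain i where "i < length us" "us ! i = fst e" by (auto simp: in_set_conv_nth)
    then have "vs ! i = fst e" "vs ! length us = v" "length us < length vs"
      unfolding assms by (auto simp: nth_append)
    then show "edge_before vs e (v, u)"
      unfolding edge_before_def using e \<open>i < length us\<close> by (metis fst_conv snd_conv)
  qed
  then show ?thesis unfolding alpha_def load_def by simp
qed

lemma flow_bounds:
  assumes "vs = us @ v # rest"
  shows "0 \<le> flow v u" "flow v u \<le> p v * (1 - load us u)"
proof -
  have "v \<in> A" using assms set_vs by auto
  then have "0 \<le> p v * (1 - load us u)" using p_bounds load_le_1[of us u] by simp
  then show "0 \<le> flow v u" "flow v u \<le> p v * (1 - load us u)"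
    unfolding flow_def using x_nonneg x_le[of v u] alpha_eq_load[OF assms] by auto
qed

text \<open>The third family of LP constraints is what makes these quotients probabilities; a zero
  denominator yields \<open>0\<close>.\<close>

lemma prop_prob_bounds:
  assumes "vs = us @ v # rest"
  shows "0 \<le> prop_prob us v u" "prop_prob us v u \<le> 1"
proof -
  have "0 \<le> p v * (1 - load us u)" using flow_bounds[OF assms, of u] by linarith
  then show "0 \<le> prop_prob us v u" "prop_prob us v u \<le> 1"
    unfolding prop_prob_def using flow_bounds[OF assms, of u] \<open>0 \<le> p v * (1 - load us u)\<close>
    by (auto simp only: divide_nonneg_nonneg divide_le_eq_1)
qed

text \<open>
  If \<open>p v * (1 - load us u) = 0\<close>, the quotient \<open>prop_prob us v u\<close> is \<open>0\<close>, but then feasibility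
  makes the flow vanish as well.
\<close>

lemma prop_prob_times:
  assumes "vs = us @ v # rest"
  shows "p v * prop_prob us v u * (1 - load us u) = flow v u"
proof (cases "p v * (1 - load us u) = 0")
  case True
  then have "flow v u = 0" using flow_bounds[OF assms, of u] by linarith
  then show ?thesis by (simp add: prop_prob_def)
next
  case False
  then show ?thesis by (simp add: prop_prob_def)
qed

section \<open>Distribution of the proposals\<close>

lemma set_proposals:
  assumes "P \<in> set_pmf (proposals E p vs x v M)"
  shows "P \<subseteq> {e \<in> E. fst e = v \<and> snd e \<notin> snd ` M}"
proof -
  let ?C = "{e \<in> E. fst e = v \<and> snd e \<notin> snd ` M \<and> x e > 0}"
  obtain f where "P = {e \<in> ?C. f e}"
    using assms unfolding proposals_def Let_def set_map_pmf by blast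
  then show ?thesis by blast
qed

lemma finite_set_proposals: "finite (set_pmf (proposals E p vs x v M))"
proof (rule finite_subset)
  show "set_pmf (proposals E p vs x v M) \<subseteq> Pow E"
    using set_proposals by blast
qed (simp add: finite_E)

text \<open>Given the current matching, the proposals are independent. The indicator switches off
  the factors of matched vertices, so that \<open>S\<close> can be any finite set, chosen without
  regard to \<open>M\<close>.\<close>

lemma prob_no_proposal:
  assumes vs: "vs = us @ v # rest" and "finite S"
  shows "measure_pmf.prob (proposals E p vs x v M) {P. \<forall>u\<in>S. (v, u) \<notin> P}
    = (\<Prod>u\<in>S. 1 - prop_prob us v u * of_bool (u \<notin> snd ` M))"
proof -
  define C where "C = {e \<in> E. fst e = v \<and> snd e \<notin> snd ` M \<and> x e > 0}"
  define S' where "S' = {u \<in> S. (v, u) \<in> C}"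
  define q where "q = (\<lambda>e. x e / (p v * (1 - alpha E vs x e)))"
  have finC: "finite C" unfolding C_def using finite_E by auto
  have C: "e = (v, snd e)" "q e = prop_prob us v (snd e)" if "e \<in> C" for e
  proof -
    show e: "e = (v, snd e)" using that by (auto simp: C_def)
    have "e \<in> E" using that by (simp add: C_def)
    then show "q e = prop_prob us v (snd e)"
      unfolding q_def prop_prob_def using e alpha_eq_load[OF vs, of "snd e"]
      by (simp add: flow_def)
  qed
  \<comment> \<open>The event is a box: the coordinate of \<open>e\<close> is forced to
    \<open>False\<close> if its end lies in \<open>S\<close> and is unconstrained otherwise. Hence
    its probability factors.\<close>
  have "(\<lambda>f. {e \<in> C. f e}) -` {P. \<forall>u\<in>S. (v, u) \<notin> P}
      = Pi C (\<lambda>e. if snd e \<in> S then {False} else UNIV)"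
  proof (intro equalityI subsetI)
    fix f assume f: "f \<in> (\<lambda>f. {e \<in> C. f e}) -` {P. \<forall>u\<in>S. (v, u) \<notin> P}"
    show "f \<in> Pi C (\<lambda>e. if snd e \<in> S then {False} else UNIV)"
    proof (rule Pi_I)
      fix e assume "e \<in> C"
      with f C(1)[of e] show "f e \<in> (if snd e \<in> S then {False} else UNIV)"
        by (cases e) auto
    qed
  next
    fix f assume f: "f \<in> Pi C (\<lambda>e. if snd e \<in> S then {False} else UNIV)"
    then show "f \<in> (\<lambda>f. {e \<in> C. f e}) -` {P. \<forall>u\<in>S. (v, u) \<notin> P}"
      by (force simp: Pi_def)
  qed
  then have "measure_pmf.prob (proposals E p vs x v M) {P. \<forall>u\<in>S. (v, u) \<notin> P}
      = (\<Prod>e\<in>C. measure_pmf.prob (bernoulli_pmf (q e)) (if snd e \<in> S then {False} else UNIV))"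
    unfolding proposals_def Let_def C_def[symmetric] q_def measure_map_pmf
    by (simp only: measure_Pi_pmf_Pi[OF finC])
  also have "\<dots> = (\<Prod>e\<in>C. if snd e \<in> S then 1 - prop_prob us v (snd e) else 1)"
    using C(2) prop_prob_bounds[OF vs]
    by (intro prod.cong) (auto simp: measure_pmf_single)
  also have "\<dots> = (\<Prod>e\<in>{e \<in> C. snd e \<in> S}. 1 - prop_prob us v (snd e))"
    using finC by (simp add: prod.inter_filter)
  also have "\<dots> = (\<Prod>u\<in>S'. 1 - prop_prob us v u)"
  proof (rule prod.reindex_bij_witness[of _ "Pair v" snd])
    fix e assume "e \<in> {e \<in> C. snd e \<in> S}"
    then show "(v, snd e) = e" "snd e \<in> S'" using C(1)[of e] unfolding S'_def by auto
  qed (auto simp: S'_def)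
  \<comment> \<open>A vertex of \<open>S - S'\<close> is matched or has zero flow, so its factor is
    \<open>1\<close>.\<close>
  also have "\<dots> = (\<Prod>u\<in>S. 1 - prop_prob us v u * of_bool (u \<notin> snd ` M))"
  proof (rule prod.mono_neutral_cong_left[OF \<open>finite S\<close>])
    show "S' \<subseteq> S" unfolding S'_def by auto
    show "\<forall>u\<in>S - S'. 1 - prop_prob us v u * of_bool (u \<notin> snd ` M) = 1"
    proof
      fix u assume "u \<in> S - S'"
      then have "u \<in> snd ` M \<or> (v, u) \<notin> E \<or> \<not> x (v, u) > 0" by (auto simp: S'_def C_def)
      then have "u \<in> snd ` M \<or> flow v u = 0"
        using x_nonneg[of "(v, u)"] by (auto simp: flow_def)
      then show "1 - prop_prob us v u * of_bool (u \<notin> snd ` M) = 1"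
        by (auto simp: prop_prob_def)
    qed
  qed (auto simp: S'_def C_def)
  finally show ?thesis .
qed

section \<open>A single step of the procedure\<close>

abbreviation step :: "'a \<Rightarrow> ('a \<times> 'b) set \<Rightarrow> ('a \<times> 'b) set pmf" where
  "step \<equiv> rounding_step E p vs x pick"

lemma set_pick:
  assumes "P \<in> set_pmf (proposals E p vs x v M)" "P \<noteq> {}" "e \<in> set_pmf (pick M P)"
  shows "e \<in> P" "\<And>e'. e' \<in> P \<Longrightarrow> w e' \<le> w e"
proof -
  have "P \<subseteq> E" using set_proposals[OF assms(1)] by blast
  then have "set_pmf (pick M P) \<subseteq> {e \<in> P. \<forall>e'\<in>P. w e' \<le> w e}"
    using rule assms(2) unfolding max_weight_rule_def by blast
  then show "e \<in> P" "\<And>e'. e' \<in> P \<Longrightarrow> w e' \<le> w e"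
    using assms(3) by auto
qed

lemma finite_set_pick:
  assumes "P \<in> set_pmf (proposals E p vs x v M)" "P \<noteq> {}"
  shows "finite (set_pmf (pick M P))"
proof (rule finite_subset)
  show "set_pmf (pick M P) \<subseteq> E"
    using set_proposals[OF assms(1)] set_pick(1)[OF assms] by blast
qed (rule finite_E)

lemma set_step:
  assumes "M' \<in> set_pmf (step v M)"
  obtains "M' = M" | u where "M' = insert (v, u) M" "(v, u) \<in> E" "u \<notin> snd ` M"
proof -
  from assms obtain P b where P: "P \<in> set_pmf (proposals E p vs x v M)"
    and M': "M' \<in> set_pmf (if P \<noteq> {} \<and> b then map_pmf (\<lambda>e. insert e M) (pick M P) else return_pmf M)"
    unfolding rounding_step_def by auto
  show ?thesis
  proof (cases "P \<noteq> {} \<and> b")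
    case True
    then obtain e where e: "e \<in> set_pmf (pick M P)" "M' = insert e M" using M' by auto
    then have "e \<in> {e \<in> E. fst e = v \<and> snd e \<notin> snd ` M}"
      using set_pick(1)[OF P _ e(1)] set_proposals[OF P] True by blast
    then show ?thesis using e that(2)[of "snd e"] by (cases e) auto
  next
    case False
    then have "M' = M" using M' by auto
    then show ?thesis by (rule that(1))
  qed
qed

lemma finite_set_step: "finite (set_pmf (step v M))"
proof (rule finite_subset)
  show "set_pmf (step v M) \<subseteq> insert M ((\<lambda>e. insert e M) ` E)"
    by (auto elim!: set_step)
qed (use finite_E in auto)

text \<open>Averages out the realization of \<open>v\<close>, which is drawn independently of the
  proposals. Empty \<open>P\<close> is kept apart because the rule says nothing about
  \<open>pick M {}\<close>.\<close>

lemma expectation_step: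
  fixes f :: "('a \<times> 'b) set \<Rightarrow> real"
  assumes "v \<in> A"
  shows "measure_pmf.expectation (step v M) f
    = measure_pmf.expectation (proposals E p vs x v M) (\<lambda>P. if P = {} then f M
        else p v * measure_pmf.expectation (pick M P) (\<lambda>e. f (insert e M)) + (1 - p v) * f M)"
proof -
  let ?K = "\<lambda>P b. if P \<noteq> {} \<and> b then map_pmf (\<lambda>e. insert e M) (pick M P) else return_pmf M"
  have finb: "finite (set_pmf (bernoulli_pmf (p v)))"
    by (rule finite_subset[of _ UNIV]) auto
  have finK: "finite (set_pmf (?K P b))" if "P \<in> set_pmf (proposals E p vs x v M)" for P b
    using finite_set_pick[OF that] by auto
  have "measure_pmf.expectation (step v M) f = measure_pmf.expectation (proposals E p vs x v M)
      (\<lambda>P. measure_pmf.expectation (bernoulli_pmf (p v) \<bind> ?K P) f)"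
    unfolding rounding_step_def
  proof (rule expectation_bind_finite[OF finite_set_proposals])
    show "finite (set_pmf (bernoulli_pmf (p v) \<bind> ?K P))" if "P \<in> set_pmf (proposals E p vs x v M)" for P
      unfolding set_bind_pmf using finb finK[OF that] by (rule finite_UN_I)
  qed
  also have "\<dots> = measure_pmf.expectation (proposals E p vs x v M) (\<lambda>P. if P = {} then f M
        else p v * measure_pmf.expectation (pick M P) (\<lambda>e. f (insert e M)) + (1 - p v) * f M)"
  proof (rule expectation_cong_pmf)
    fix P assume P: "P \<in> set_pmf (proposals E p vs x v M)"
    have "measure_pmf.expectation (bernoulli_pmf (p v) \<bind> ?K P) f
        = measure_pmf.expectation (bernoulli_pmf (p v)) (\<lambda>b. measure_pmf.expectation (?K P b) f)"
      by (rule expectation_bind_finite[OF finb finK[OF P]])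
    also have "\<dots> = p v * measure_pmf.expectation (?K P True) f + (1 - p v) * measure_pmf.expectation (?K P False) f"
      using p_bounds[OF assms] by (simp only: integral_bernoulli_pmf mult.commute)
    finally show "measure_pmf.expectation (bernoulli_pmf (p v) \<bind> ?K P) f = (if P = {} then f M
        else p v * measure_pmf.expectation (pick M P) (\<lambda>e. f (insert e M)) + (1 - p v) * f M)"
      by (cases "P = {}") (simp_all add: algebra_simps)
  qed
  finally show ?thesis .
qed

text \<open>A free \<open>u\<close> can be taken only if it proposes and \<open>v\<close> is
  realized, two independent events. Equality can fail because another proposal may be
  picked.\<close>

lemma prob_matched_in_step:
  assumes vs: "vs = us @ v # rest" and "u \<notin> snd ` M"
  shows "measure_pmf.expectation (step v M) (\<lambda>M'. of_bool (u \<in> snd ` M')) \<le> p v * prop_prob us v u"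
proof -
  have v: "v \<in> A" using vs set_vs by auto
  let ?N = "proposals E p vs x v M"
  \<comment> \<open>Quantifying over the singleton \<open>{u}\<close> puts the event into the form
    of \<open>prob_no_proposal\<close>.\<close>
  have "measure_pmf.expectation (step v M) (\<lambda>M'. of_bool (u \<in> snd ` M') :: real)
      \<le> measure_pmf.expectation ?N (\<lambda>P. p v * (1 - of_bool (\<forall>u\<in>{u}. (v, u) \<notin> P)))"
    unfolding expectation_step[OF v]
  proof (rule expectation_mono_finite[OF finite_set_proposals])
    fix P assume P: "P \<in> set_pmf ?N"
    let ?f = "\<lambda>e. of_bool (u \<in> snd ` insert e M) :: real"
    have "measure_pmf.expectation (pick M P) ?f \<le> 1 - of_bool ((v, u) \<notin> P)" if "P \<noteq> {}"
    proof (cases "(v, u) \<in> P")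
      case True
      have "measure_pmf.expectation (pick M P) ?f \<le> measure_pmf.expectation (pick M P) (\<lambda>_. 1)"
        by (rule expectation_mono_finite[OF finite_set_pick[OF P that]]) auto
      then show ?thesis using True by simp
    next
      case False
      have "measure_pmf.expectation (pick M P) ?f = measure_pmf.expectation (pick M P) (\<lambda>_. 0)"
      proof (rule expectation_cong_pmf)
        fix e assume "e \<in> set_pmf (pick M P)"
        then have "e \<in> P" "fst e = v" using set_pick(1)[OF P that] set_proposals[OF P] by blast+
        then have "snd e \<noteq> u" using False by (cases e) auto
        then show "?f e = 0" using assms(2) by auto
      qed
      then show ?thesis using False by simp
    qed
    then have "P \<noteq> {} \<Longrightarrow> p v * measure_pmf.expectation (pick M P) ?f \<le> p v * (1 - of_bool ((v, u) \<notin> P))"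
      using p_bounds[OF v] by (intro mult_left_mono)
    then show "(if P = {} then of_bool (u \<in> snd ` M)
        else p v * measure_pmf.expectation (pick M P) ?f + (1 - p v) * of_bool (u \<in> snd ` M))
        \<le> p v * (1 - of_bool (\<forall>u\<in>{u}. (v, u) \<notin> P))"
      using assms(2) by auto
  qed
  also have "\<dots> = p v * (1 - measure_pmf.prob ?N {P. \<forall>u\<in>{u}. (v, u) \<notin> P})"
    by (subst integral_mult_right_zero, subst expectation_one_minus[OF finite_set_proposals],
      subst expectation_of_bool) (rule refl)
  also have "\<dots> = p v * prop_prob us v u"
    using prob_no_proposal[OF vs, of "{u}" M] assms(2) by simp
  finally show ?thesis .
qed

text \<open>At most one free vertex is taken in a step, so the product is affine in the indicators
  of being taken. Its expectation thus needs only the individual probabilities from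
  \<open>prob_matched_in_step\<close>, and \<open>prod_one_minus_flip_le\<close> folds the resulting
  first-order expansion back into a product.\<close>

lemma expectation_step_prod_le:
  assumes vs: "vs = us @ v # rest" and S: "finite S" "\<And>u. u \<in> S \<Longrightarrow> 0 \<le> c u \<and> c u \<le> 1"
  shows "measure_pmf.expectation (step v M) (\<lambda>M'. \<Prod>u\<in>S. 1 - c u * of_bool (u \<notin> snd ` M'))
    \<le> (\<Prod>u\<in>S. 1 - c u * (1 - p v * prop_prob us v u) * of_bool (u \<notin> snd ` M))"
proof -
  define T where "T = {u \<in> S. u \<notin> snd ` M}"
  have finT: "finite T" using S by (simp add: T_def)
  \<comment> \<open>Vertices matched in \<open>M\<close> have factor \<open>1\<close>, and keep it
    because the matching only grows.\<close>
  have T: "(\<Prod>u\<in>S. 1 - g u * of_bool (u \<notin> snd ` M')) = (\<Prod>u\<in>T. 1 - g u * of_bool (u \<notin> snd ` M'))"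
    if "M \<subseteq> M'" for M' and g :: "'b \<Rightarrow> real"
    using S that by (intro prod.mono_neutral_right) (auto simp: T_def)
  \<comment> \<open>\<open>d u\<close> is the increase of the product when \<open>u\<close> is taken
    and its factor changes from \<open>1 - c u\<close> to \<open>1\<close>.\<close>
  define d where "d = (\<lambda>u. c u * (\<Prod>u'\<in>T - {u}. 1 - c u'))"
  have d0: "0 \<le> d u" if "u \<in> T" for u
    unfolding d_def using S that by (auto simp: T_def intro!: mult_nonneg_nonneg prod_nonneg)
  have "measure_pmf.expectation (step v M) (\<lambda>M'. \<Prod>u\<in>S. 1 - c u * of_bool (u \<notin> snd ` M'))
    \<le> measure_pmf.expectation (step v M) (\<lambda>M'. (\<Prod>u\<in>T. 1 - c u) + (\<Sum>u\<in>T. d u * of_bool (u \<in> snd ` M')))"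
  proof (rule expectation_mono_finite[OF finite_set_step])
    fix M' assume "M' \<in> set_pmf (step v M)"
    then show "(\<Prod>u\<in>S. 1 - c u * of_bool (u \<notin> snd ` M')) \<le> (\<Prod>u\<in>T. 1 - c u) + (\<Sum>u\<in>T. d u * of_bool (u \<in> snd ` M'))"
    proof (cases rule: set_step)
      case 1
      have "(\<Sum>u\<in>T. d u * of_bool (u \<in> snd ` M')) = 0" using 1 by (auto simp: T_def)
      moreover have "(\<Prod>u\<in>T. 1 - c u * of_bool (u \<notin> snd ` M')) = (\<Prod>u\<in>T. 1 - c u)"
        using 1 by (intro prod.cong) (auto simp: T_def)
      ultimately show ?thesis using T[of M' c] 1 by simp
    next
      case (2 y)
      show ?thesis
      proof (cases "y \<in> T")
        case True
        have "(\<Sum>u\<in>T. d u * of_bool (u \<in> snd ` M')) = (\<Sum>u\<in>T. if u = y then d y else 0)"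
          using 2 by (intro sum.cong) (auto simp: T_def)
        then have "(\<Sum>u\<in>T. d u * of_bool (u \<in> snd ` M')) = d y" using True finT by simp
        moreover have "(\<Prod>u\<in>T. 1 - c u * of_bool (u \<notin> snd ` M')) = (\<Prod>u\<in>T - {y}. 1 - c u)"
          using 2 finT True unfolding prod.remove[OF finT True]
          by (auto simp: T_def intro!: prod.cong)
        ultimately show ?thesis
          using T[of M' c] 2 by (simp add: prod.remove[OF finT True, of "\<lambda>u. 1 - c u"] d_def algebra_simps subset_insertI)
      next
        case False
        have "(\<Sum>u\<in>T. d u * of_bool (u \<in> snd ` M')) = 0"
          using 2 False by (intro sum.neutral) (auto simp: T_def)
        moreover have "(\<Prod>u\<in>T. 1 - c u * of_bool (u \<notin> snd ` M')) = (\<Prod>u\<in>T. 1 - c u)"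
          using 2 False by (intro prod.cong) (auto simp: T_def)
        ultimately show ?thesis using T[of M' c] 2 by (simp add: subset_insertI)
      qed
    qed
  qed
  also have "\<dots> = (\<Prod>u\<in>T. 1 - c u) + (\<Sum>u\<in>T. d u * measure_pmf.expectation (step v M) (\<lambda>M'. of_bool (u \<in> snd ` M')))"
    by (rule expectation_add_const_sum[OF finite_set_step])
  also have "\<dots> \<le> (\<Prod>u\<in>T. 1 - c u) + (\<Sum>u\<in>T. d u * (p v * prop_prob us v u))"
    using d0 prob_matched_in_step[OF vs]
    by (intro add_left_mono sum_mono mult_left_mono) (auto simp: T_def)
  also have "\<dots> = (\<Prod>u\<in>T. 1 - c u) + (\<Sum>u\<in>T. c u * p v * prop_prob us v u * (\<Prod>u'\<in>T - {u}. 1 - c u'))"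
    by (simp add: d_def algebra_simps)
  also have "\<dots> \<le> (\<Prod>u\<in>T. 1 - c u + c u * p v * prop_prob us v u)"
    using S finT p_bounds(1)[of v] prop_prob_bounds(1)[OF vs] vs set_vs
    by (intro prod_one_minus_flip_le) (auto simp: T_def)
  also have "\<dots> = (\<Prod>u\<in>T. 1 - c u * (1 - p v * prop_prob us v u) * of_bool (u \<notin> snd ` M))"
    by (intro prod.cong) (auto simp: T_def algebra_simps)
  also have "\<dots> = (\<Prod>u\<in>S. 1 - c u * (1 - p v * prop_prob us v u) * of_bool (u \<notin> snd ` M))"
    by (rule T[symmetric]) simp
  finally show ?thesis .
qed

section \<open>The matching after a prefix of the arrivals\<close>

definition run :: "'a list \<Rightarrow> ('a \<times> 'b) set pmf" where
  "run us = foldl (\<lambda>\<mu> v. bind_pmf \<mu> (step v)) (return_pmf {}) us"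

lemma run_Nil: "run [] = return_pmf {}" and run_snoc: "run (us @ [v]) = bind_pmf (run us) (step v)"
  unfolding run_def by simp_all

text \<open>The inclusion shows that an arriving vertex is still unmatched, so that its edge adds
  full weight; injectivity makes the \<open>THE\<close> in \<open>WM\<close> well defined.\<close>

lemma set_run:
  assumes "M \<in> set_pmf (run us)" "distinct us"
  shows "M \<subseteq> {e \<in> E. fst e \<in> set us} \<and> inj_on fst M"
  using assms
proof (induction us arbitrary: M rule: rev_induct)
  case Nil then show ?case by (simp add: run_Nil)
next
  case (snoc v us)
  then obtain N where "N \<in> set_pmf (run us)" and M: "M \<in> set_pmf (step v N)"
    by (auto simp: run_snoc)
  then have N: "N \<subseteq> {e \<in> E. fst e \<in> set us}" "inj_on fst N" using snoc by auto
  from M show ?case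
  proof (cases rule: set_step)
    case 1
    with N show ?thesis by auto
  next
    case (2 u)
    moreover have "v \<notin> fst ` N" using N snoc.prems by auto
    ultimately show ?thesis using N by auto
  qed
qed

lemma finite_set_run: "finite (set_pmf (run us))"
proof (induction us rule: rev_induct)
  case Nil
  show ?case by (simp add: run_Nil)
next
  case (snoc v us)
  then show ?case unfolding run_snoc set_bind_pmf using finite_set_step by (rule finite_UN_I)
qed

text \<open>Equality would hold if each \<open>u\<close> were free independently with probability
  \<open>1 - load us u\<close>. The induction peels off the last arrival, and \<open>c\<close> is
  arbitrary because that changes the coefficients.\<close>

lemma expectation_free_prod_le:
  assumes "vs = us @ rest" "finite S" "\<And>u. u \<in> S \<Longrightarrow> 0 \<le> c u \<and> c u \<le> 1"
  shows "measure_pmf.expectation (run us) (\<lambda>M. \<Prod>u\<in>S. 1 - c u * of_bool (u \<notin> snd ` M))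
    \<le> (\<Prod>u\<in>S. 1 - c u * (1 - load us u))"
  using assms
proof (induction us arbitrary: rest c rule: rev_induct)
  case Nil
  show ?case unfolding run_Nil by (simp add: load_def)
next
  case (snoc v us)
  have vs: "vs = us @ v # rest" using snoc.prems by simp
  have v: "v \<in> A" "v \<notin> set us" using vs set_vs distinct_vs by auto
  let ?r = "\<lambda>u. p v * prop_prob us v u"
  have r: "0 \<le> ?r u" "?r u \<le> 1" for u
    using p_bounds[OF v(1)] prop_prob_bounds[OF vs, of u] by (auto intro: mult_le_one)
  have "measure_pmf.expectation (run (us @ [v])) (\<lambda>M. \<Prod>u\<in>S. 1 - c u * of_bool (u \<notin> snd ` M))
    = measure_pmf.expectation (run us) (\<lambda>M. measure_pmf.expectation (step v M) (\<lambda>M'. \<Prod>u\<in>S. 1 - c u * of_bool (u \<notin> snd ` M')))"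
    unfolding run_snoc by (rule expectation_bind_finite[OF finite_set_run finite_set_step])
  also have "\<dots> \<le> measure_pmf.expectation (run us) (\<lambda>M. \<Prod>u\<in>S. 1 - c u * (1 - ?r u) * of_bool (u \<notin> snd ` M))"
    using expectation_step_prod_le[OF vs] snoc.prems by (intro expectation_mono_finite[OF finite_set_run]) blast
  also have "\<dots> \<le> (\<Prod>u\<in>S. 1 - c u * (1 - ?r u) * (1 - load us u))"
  proof (rule snoc.IH[OF vs snoc.prems(2)])
    fix u assume "u \<in> S"
    then show "0 \<le> c u * (1 - ?r u) \<and> c u * (1 - ?r u) \<le> 1"
      using snoc.prems(3)[of u] r[of u] by (auto intro: mult_le_one)
  qed
  \<comment> \<open>By \<open>prop_prob_times\<close>, \<open>?r u * (1 - load us u)\<close> is the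
    flow on \<open>(v, u)\<close>, which is exactly the growth of the load.\<close>
  also have "(1 - ?r u) * (1 - load us u) = 1 - load (us @ [v]) u" for u
  proof -
    have "(1 - ?r u) * (1 - load us u) = 1 - load us u - ?r u * (1 - load us u)"
      by (simp add: algebra_simps)
    then show ?thesis using prop_prob_times[OF vs, of u] load_snoc[OF v(2), of u] by linarith
  qed
  then have "(\<Prod>u\<in>S. 1 - c u * (1 - ?r u) * (1 - load us u)) = (\<Prod>u\<in>S. 1 - c u * (1 - load (us @ [v]) u))"
    by (simp only: mult.assoc)
  finally show ?case .
qed

text \<open>\<open>S\<close> will be the set of neighbours above a weight threshold, so the event
  says that the best proposal reaches that threshold. Scaling by \<open>p v\<close> covers
  \<open>p v = 0\<close>, where the LP forces all flow at \<open>v\<close> to vanish.\<close>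

lemma prob_heavy_proposal_ge:
  assumes vs: "vs = us @ v # rest" and S: "S \<subseteq> {u. (v, u) \<in> E}"
  shows "(1 - 1 / exp 1) * (\<Sum>u\<in>S. flow v u)
    \<le> p v * measure_pmf.expectation (run us)
        (\<lambda>M. measure_pmf.expectation (proposals E p vs x v M) (\<lambda>P. of_bool (\<exists>u\<in>S. (v, u) \<in> P)))"
    (is "_ \<le> p v * ?X")
proof (cases "p v = 0")
  case True
  then have "flow v u = 0" for u using prop_prob_times[OF vs, of u] by simp
  then show ?thesis using True by simp
next
  case False
  have v: "v \<in> A" using vs set_vs by auto
  then have p: "0 < p v" using p_bounds[OF v] False by simp
  have finS: "finite S"
    using S by (intro finite_subset[OF _ finite_imageI[OF finite_E, of snd]]) force
  \<comment> \<open>The LP flow conditioned on the arrival of \<open>v\<close>. It equals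
    \<open>prop_prob us v u * (1 - load us u)\<close>, the term in
    \<open>expectation_free_prod_le\<close> for \<open>c = prop_prob us v\<close>.\<close>
  define y where "y = (\<lambda>u. flow v u / p v)"
  have y: "prop_prob us v u * (1 - load us u) = y u" "0 \<le> y u" for u
    using prop_prob_times[OF vs, of u] p flow_bounds(1)[OF vs, of u] by (auto simp: y_def field_simps)
  \<comment> \<open>The LP constraint at \<open>v\<close> bounds the sum of the \<open>y u\<close>
    by \<open>1\<close>, the range in which the chord estimate applies.\<close>
  have "(\<Sum>u\<in>S. flow v u) = (\<Sum>e\<in>Pair v ` S. x e)"
    using S by (subst sum.reindex) (auto simp: inj_on_def flow_def intro!: sum.cong)
  also have "\<dots> \<le> (\<Sum>e\<in>{e \<in> E. fst e = v}. x e)"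
    using S finite_E x_nonneg by (intro sum_mono2) auto
  also have "\<dots> \<le> p v" using feasible v unfolding LP_V_feasible_def by blast
  finally have sum_y: "(\<Sum>u\<in>S. y u) \<le> 1" using p by (simp add: y_def sum_divide_distrib[symmetric])
  have y1: "y u \<le> 1" if "u \<in> S" for u
    using member_le_sum[OF that, of y] finS y(2) sum_y by force
  have "measure_pmf.expectation (proposals E p vs x v M) (\<lambda>P. of_bool (\<exists>u\<in>S. (v, u) \<in> P))
      = 1 - (\<Prod>u\<in>S. 1 - prop_prob us v u * of_bool (u \<notin> snd ` M))" for M
  proof -
    have "(\<lambda>P. of_bool (\<exists>u\<in>S. (v, u) \<in> P) :: real) = (\<lambda>P. 1 - of_bool (\<forall>u\<in>S. (v, u) \<notin> P))"
      by auto
    then show ?thesis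
      by (simp only: expectation_one_minus[OF finite_set_proposals] expectation_of_bool
          prob_no_proposal[OF vs finS])
  qed
  then have "?X = 1 - measure_pmf.expectation (run us)
      (\<lambda>M. \<Prod>u\<in>S. 1 - prop_prob us v u * of_bool (u \<notin> snd ` M))"
    by (simp only: expectation_one_minus[OF finite_set_run])
  also have "\<dots> \<ge> 1 - (\<Prod>u\<in>S. 1 - y u)"
    using expectation_free_prod_le[OF vs finS, of "prop_prob us v"] prop_prob_bounds[OF vs] y by simp
  finally have "1 - (\<Prod>u\<in>S. 1 - y u) \<le> ?X" .
  moreover have "(\<Prod>u\<in>S. 1 - y u) \<le> exp (- (\<Sum>u\<in>S. y u))"
    by (rule prod_one_minus_le_exp[OF y1])
  moreover have "(1 - 1 / exp 1) * (\<Sum>u\<in>S. y u) \<le> 1 - exp (- (\<Sum>u\<in>S. y u))"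
    using sum_y y by (intro one_minus_exp_ge_chord sum_nonneg) auto
  ultimately have "(1 - 1 / exp 1) * (\<Sum>u\<in>S. y u) \<le> ?X" by linarith
  then have "p v * ((1 - 1 / exp 1) * (\<Sum>u\<in>S. y u)) \<le> p v * ?X" using p by simp
  moreover have "p v * (\<Sum>u\<in>S. y u) = (\<Sum>u\<in>S. flow v u)"
    using p by (simp add: y_def sum_distrib_left)
  then have "p v * ((1 - 1 / exp 1) * (\<Sum>u\<in>S. y u)) = (1 - 1 / exp 1) * (\<Sum>u\<in>S. flow v u)"
    by (metis mult.left_commute)
  ultimately show ?thesis by simp
qed

text \<open>\<open>h\<close> stands for a lower estimate of the best proposed weight. The
  maximum-weight rule enters here: \<open>h P\<close> is compared only with a heaviest edge of
  \<open>P\<close>.\<close>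

lemma expectation_step_weight_ge:
  assumes "v \<in> A" "finite M" "v \<notin> fst ` M"
    and h: "h {} \<le> 0"
      "\<And>P e. P \<subseteq> {e \<in> E. fst e = v} \<Longrightarrow> e \<in> P \<Longrightarrow> (\<And>e'. e' \<in> P \<Longrightarrow> w e' \<le> w e) \<Longrightarrow> h P \<le> w e"
  shows "sum w M + p v * measure_pmf.expectation (proposals E p vs x v M) h
    \<le> measure_pmf.expectation (step v M) (sum w)"
proof -
  let ?N = "proposals E p vs x v M"
  \<comment> \<open>The index type \<open>unit\<close> reduces the sum in
    \<open>expectation_add_const_sum\<close> to one term.\<close>
  have "sum w M + p v * measure_pmf.expectation ?N h
      = measure_pmf.expectation ?N (\<lambda>P. sum w M + p v * h P)"
    using expectation_add_const_sum[OF finite_set_proposals, of v M "sum w M" "\<lambda>_. p v" "\<lambda>_::unit. h" UNIV]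
    by simp
  also have "\<dots> \<le> measure_pmf.expectation (step v M) (sum w)"
    unfolding expectation_step[OF assms(1)]
  proof (rule expectation_mono_finite[OF finite_set_proposals])
    fix P assume P: "P \<in> set_pmf ?N"
    show "sum w M + p v * h P \<le> (if P = {} then sum w M
       else p v * measure_pmf.expectation (pick M P) (\<lambda>e. sum w (insert e M)) + (1 - p v) * sum w M)"
    proof (cases "P = {}")
      case True
      then show ?thesis using h(1) p_bounds(1)[OF assms(1)] by (simp add: mult_nonneg_nonpos)
    next
      case False
      have "sum w M + h P = measure_pmf.expectation (pick M P) (\<lambda>_. sum w M + h P)" by simp
      also have "\<dots> \<le> measure_pmf.expectation (pick M P) (\<lambda>e. sum w (insert e M))"
      proof (rule expectation_mono_finite[OF finite_set_pick[OF P False]])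
        fix e assume e: "e \<in> set_pmf (pick M P)"
        have "h P \<le> w e"
          using set_pick[OF P False e] set_proposals[OF P] by (intro h(2)) auto
        moreover have "fst e = v"
          using set_pick(1)[OF P False e] set_proposals[OF P] by blast
        then have "e \<notin> M" using assms(3) by auto
        ultimately show "sum w M + h P \<le> sum w (insert e M)" using assms(2) by simp
      qed
      finally have "p v * (sum w M + h P) \<le> p v * measure_pmf.expectation (pick M P) (\<lambda>e. sum w (insert e M))"
        using p_bounds(1)[OF assms(1)] by (intro mult_left_mono)
      then show ?thesis using False by (simp add: algebra_simps)
    qed
  qed
  finally show ?thesis .
qed

text \<open>Layering the weights at \<open>v\<close> reduces the claim to one instance of
  \<open>prob_heavy_proposal_ge\<close> per threshold, and the layers recombine with non-negative
  coefficients.\<close>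

lemma expectation_run_snoc_weight_ge:
  assumes vs: "vs = us @ v # rest"
  shows "measure_pmf.expectation (run us) (sum w) + (1 - 1 / exp 1) * (\<Sum>e\<in>{e \<in> E. fst e = v}. w e * x e)
    \<le> measure_pmf.expectation (run (us @ [v])) (sum w)"
proof -
  have v: "v \<in> A" "v \<notin> set us" and us: "distinct us" using vs set_vs distinct_vs by auto
  define N where "N = {u. (v, u) \<in> E}"
  have finN: "finite N"
    unfolding N_def by (intro finite_subset[OF _ finite_imageI[OF finite_E, of snd]]) force
  define W where "W = (\<lambda>u. w (v, u)) ` N"
  have "finite W" "\<And>y. y \<in> W \<Longrightarrow> 0 \<le> y" using finN weight_nonneg by (auto simp: W_def N_def)
  from layer_decomposition[OF this] obtain l where l: "\<And>\<theta>. \<theta> \<in> W \<Longrightarrow> 0 \<le> l \<theta>"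
    "\<And>y. y \<in> W \<Longrightarrow> y = (\<Sum>\<theta>\<in>{\<theta>\<in>W. \<theta> \<le> y}. l \<theta>)" by blast
  define S where "S = (\<lambda>\<theta>. {u \<in> N. \<theta> \<le> w (v, u)})"
  \<comment> \<open>The layered form of the largest weight in \<open>P\<close>: a threshold counts
    once some proposed edge reaches it.\<close>
  define h where "h = (\<lambda>P. \<Sum>\<theta>\<in>W. l \<theta> * of_bool (\<exists>u\<in>S \<theta>. (v, u) \<in> P))"
  have gain: "sum w M + p v * measure_pmf.expectation (proposals E p vs x v M) h
    \<le> measure_pmf.expectation (step v M) (sum w)" if "M \<in> set_pmf (run us)" for M
  proof (rule expectation_step_weight_ge[OF v(1)])
    show "finite M" "v \<notin> fst ` M"
      using set_run[OF that us] v finite_E by (auto intro: finite_subset)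
    show "h {} \<le> 0" by (simp add: h_def)
    fix P e assume P: "P \<subseteq> {e \<in> E. fst e = v}" "e \<in> P" "\<And>e'. e' \<in> P \<Longrightarrow> w e' \<le> w e"
    then have e: "w e \<in> W" by (cases e) (auto simp: W_def N_def)
    have "h P \<le> (\<Sum>\<theta>\<in>W. if \<theta> \<le> w e then l \<theta> else 0)"
      unfolding h_def
    proof (rule sum_mono)
      fix \<theta> assume "\<theta> \<in> W"
      moreover have "\<theta> \<le> w e" if "u \<in> S \<theta>" "(v, u) \<in> P" for u
        using that P(3)[of "(v, u)"] by (auto simp: S_def)
      ultimately show "l \<theta> * of_bool (\<exists>u\<in>S \<theta>. (v, u) \<in> P) \<le> (if \<theta> \<le> w e then l \<theta> else 0)"
        using l(1) by auto
    qed
    also have "\<dots> = (\<Sum>\<theta>\<in>{\<theta>\<in>W. \<theta> \<le> w e}. l \<theta>)"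
      using \<open>finite W\<close> by (simp add: sum.inter_filter)
    also have "\<dots> = w e" using l(2)[OF e] by simp
    finally show "h P \<le> w e" .
  qed
  have "(\<Sum>e\<in>{e \<in> E. fst e = v}. w e * x e) = (\<Sum>u\<in>N. w (v, u) * flow v u)"
    by (rule sum.reindex_bij_witness[of _ "Pair v" snd]) (auto simp: N_def flow_def)
  also have "\<dots> = (\<Sum>u\<in>N. \<Sum>\<theta>\<in>{\<theta>\<in>W. \<theta> \<le> w (v, u)}. l \<theta> * flow v u)"
    using l(2) by (intro sum.cong) (auto simp: W_def sum_distrib_right[symmetric])
  \<comment> \<open>Exchanging the sums regroups the LP value at \<open>v\<close> by
    thresholds.\<close>
  also have "\<dots> = (\<Sum>\<theta>\<in>W. \<Sum>u\<in>S \<theta>. l \<theta> * flow v u)"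
    unfolding S_def by (rule sum.swap_restrict[OF finN \<open>finite W\<close>])
  finally have "(1 - 1 / exp 1) * (\<Sum>e\<in>{e \<in> E. fst e = v}. w e * x e)
      = (\<Sum>\<theta>\<in>W. l \<theta> * ((1 - 1 / exp 1) * (\<Sum>u\<in>S \<theta>. flow v u)))"
    by (simp add: sum_distrib_left mult_ac)
  also have "\<dots> \<le> (\<Sum>\<theta>\<in>W. l \<theta> * (p v * measure_pmf.expectation (run us)
        (\<lambda>M. measure_pmf.expectation (proposals E p vs x v M) (\<lambda>P. of_bool (\<exists>u\<in>S \<theta>. (v, u) \<in> P)))))"
    using l(1) by (intro sum_mono mult_left_mono prob_heavy_proposal_ge[OF vs]) (auto simp: S_def N_def)
  also have "\<dots> = measure_pmf.expectation (run us)
        (\<lambda>M. p v * measure_pmf.expectation (proposals E p vs x v M) h)"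
    unfolding h_def
    by (simp only: expectation_add_const_sum[OF finite_set_run, where a = 0, simplified]
        expectation_add_const_sum[OF finite_set_proposals, where a = 0, simplified]
        integral_mult_right_zero mult.left_commute[of "p v"] sum_distrib_left)
  finally have "measure_pmf.expectation (run us) (sum w)
      + (1 - 1 / exp 1) * (\<Sum>e\<in>{e \<in> E. fst e = v}. w e * x e)
    \<le> measure_pmf.expectation (run us)
        (\<lambda>M. sum w M + p v * measure_pmf.expectation (proposals E p vs x v M) h)"
    by (simp add: integrable_finite_pmf[OF finite_set_run])
  also have "\<dots> \<le> measure_pmf.expectation (run us) (\<lambda>M. measure_pmf.expectation (step v M) (sum w))"
    using gain by (rule expectation_mono_finite[OF finite_set_run])
  also have "\<dots> = measure_pmf.expectation (run (us @ [v])) (sum w)"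
    unfolding run_snoc by (rule expectation_bind_finite[OF finite_set_run finite_set_step, symmetric])
  finally show ?thesis .
qed

section \<open>Total weight of the rounded matching\<close>

lemma expectation_run_weight_ge:
  assumes "vs = us @ rest"
  shows "(1 - 1 / exp 1) * (\<Sum>e\<in>{e \<in> E. fst e \<in> set us}. w e * x e)
    \<le> measure_pmf.expectation (run us) (sum w)"
  using assms
proof (induction us arbitrary: rest rule: rev_induct)
  case Nil
  show ?case unfolding run_Nil by simp
next
  case (snoc v us)
  have vs: "vs = us @ v # rest" using snoc.prems by simp
  then have "v \<notin> set us" using distinct_vs by auto
  moreover have "{e \<in> E. fst e \<in> set (us @ [v])} = {e \<in> E. fst e \<in> set us} \<union> {e \<in> E. fst e = v}"
    by auto
  ultimately have "(\<Sum>e\<in>{e \<in> E. fst e \<in> set (us @ [v])}. w e * x e)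
     = (\<Sum>e\<in>{e \<in> E. fst e \<in> set us}. w e * x e) + (\<Sum>e\<in>{e \<in> E. fst e = v}. w e * x e)"
    using finite_E by (simp only:) (rule sum.union_disjoint; auto)
  then show ?case
    using snoc.IH[OF vs] expectation_run_snoc_weight_ge[OF vs] by (simp add: distrib_left)
qed

lemma run_vs: "run vs = vertex_rounding E p vs x pick"
  unfolding run_def vertex_rounding_def ..

lemma expectation_rounding_weight_ge:
  "(1 - 1 / exp 1) * (\<Sum>e\<in>E. w e * x e)
    \<le> measure_pmf.expectation (vertex_rounding E p vs x pick) (sum w)"
proof -
  have "{e \<in> E. fst e \<in> set vs} = E" using edge_ends(1) set_vs by auto
  then show ?thesis using expectation_run_weight_ge[of vs "[]"] by (simp add: run_vs)
qed

lemma expectation_rounding_eq_sum_WM: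
  "measure_pmf.expectation (vertex_rounding E p vs x pick) (sum w)
    = (\<Sum>v\<in>A. measure_pmf.expectation (vertex_rounding E p vs x pick) (\<lambda>M. WM w M v))"
proof -
  have "sum w M = (\<Sum>v\<in>A. WM w M v)" if "M \<in> set_pmf (run vs)" for M
  proof -
    have M: "M \<subseteq> {e \<in> E. fst e \<in> set vs}" "inj_on fst M"
      using set_run[OF that distinct_vs] by auto
    have "finite A" using set_vs by auto
    \<comment> \<open>Unmatched vertices contribute \<open>0\<close>, and injectivity of
      \<open>fst\<close> on \<open>M\<close> lets the rest be summed over edges.\<close>
    then have "(\<Sum>v\<in>A. WM w M v) = (\<Sum>v\<in>fst ` M. WM w M v)"
      using M set_vs by (intro sum.mono_neutral_right) (force simp: WM_def)+
    also have "\<dots> = (\<Sum>e\<in>M. WM w M (fst e))" using M by (simp add: sum.reindex)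
    also have "\<dots> = sum w M"
    proof (rule sum.cong[OF refl])
      fix e assume e: "e \<in> M"
      then have "(THE e'. e' \<in> M \<and> fst e' = fst e) = e"
        using M(2) by (auto dest: inj_onD)
      moreover have "\<exists>u. (fst e, u) \<in> M" using e by (metis prod.collapse)
      ultimately show "WM w M (fst e) = w e" unfolding WM_def by simp
    qed
    finally show ?thesis by simp
  qed
  then have "measure_pmf.expectation (run vs) (sum w) = measure_pmf.expectation (run vs) (\<lambda>M. \<Sum>v\<in>A. WM w M v)"
    by (rule expectation_cong_pmf)
  then show ?thesis
    unfolding run_vs[symmetric]
    by (simp add: Bochner_Integration.integral_sum[OF integrable_finite_pmf[OF finite_set_run]])
qed

end

section \<open>The LP relaxation\<close>

lemma expectation_realizations_split:
  fixes h :: "(nat \<Rightarrow> bool) \<Rightarrow> real"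
  assumes "t < length vs" "0 \<le> p (vs ! t)" "p (vs ! t) \<le> 1"
  defines "R' \<equiv> Pi_pmf ({..<length vs} - {t}) False (\<lambda>t. bernoulli_pmf (p (vs ! t)))"
  shows "measure_pmf.expectation (realizations p vs) h
    = p (vs ! t) * measure_pmf.expectation R' (\<lambda>r. h (r(t := True)))
      + (1 - p (vs ! t)) * measure_pmf.expectation R' (\<lambda>r. h (r(t := False)))"
proof -
  have "insert t ({..<length vs} - {t}) = {..<length vs}" using assms by auto
  then have R: "realizations p vs = bind_pmf (bernoulli_pmf (p (vs ! t))) (\<lambda>b. map_pmf (\<lambda>r. r(t := b)) R')"
    unfolding realizations_def R'_def
    using Pi_pmf_insert'[of "{..<length vs} - {t}" t False "\<lambda>t. bernoulli_pmf (p (vs ! t))"]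
    by (simp add: map_pmf_def)
  have "finite (set_pmf R')" unfolding R'_def by (simp add: set_Pi_pmf finite_PiE_dflt)
  moreover have "finite (set_pmf (bernoulli_pmf (p (vs ! t))))"
    by (rule finite_subset[of _ UNIV]) auto
  ultimately show ?thesis
    unfolding R using assms by (subst expectation_bind_finite) (auto simp: mult.commute)
qed

text \<open>Invariance under \<open>r(t := b)\<close> expresses that \<open>h\<close> ignores the
  arrival at time \<open>t\<close>; both branches of the split then carry the same
  expectation.\<close>

lemma realization_independent:
  fixes h :: "(nat \<Rightarrow> bool) \<Rightarrow> real"
  assumes "t < length vs" "0 \<le> p (vs ! t)" "p (vs ! t) \<le> 1"
    and "\<And>r b. h (r(t := b)) = h r"
  shows "measure_pmf.expectation (realizations p vs) (\<lambda>r. of_bool (r t) * h r)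
    = p (vs ! t) * measure_pmf.expectation (realizations p vs) h"
  unfolding expectation_realizations_split[of t vs p, OF assms(1-3)] assms(4)
  by (simp add: algebra_simps)

section \<open>Matchings of a deterministic online algorithm\<close>

lemma algo_matching_iff:
  assumes "distinct vs" "t \<le> length vs" "s < length vs"
  shows "(vs ! s, u) \<in> algo_matching vs d r t \<longleftrightarrow> s < t \<and> r s \<and> d (map r [0..<Suc s]) = Some u"
  unfolding algo_matching_def using assms by (auto simp: nth_eq_iff_index_eq)

lemma algo_matching_cases:
  assumes "e \<in> algo_matching vs d r t"
  obtains s where "s < t" "r s" "fst e = vs ! s" "d (map r [0..<Suc s]) = Some (snd e)"
  using assms unfolding algo_matching_def by auto

text \<open>The online restriction enters here: decisions before time \<open>t\<close> see only
  realizations before time \<open>t\<close>.\<close>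

lemma algo_matching_upd: "algo_matching vs d (r(t := b)) t = algo_matching vs d r t"
proof -
  have "map (r(t := b)) [0..<Suc s] = map r [0..<Suc s]" if "s < t" for s
    using that by auto
  then show ?thesis
    unfolding algo_matching_def by (metis (no_types, opaque_lifting) fun_upd_other nat_neq_iff)
qed

lemma inj_on_snd_algo_matching:
  assumes "valid_algo E vs d"
  shows "inj_on snd (algo_matching vs d r (length vs))"
proof -
  \<comment> \<open>The later of two uses of \<open>u\<close> would violate validity.\<close>
  have late: False if "s < s'" "s' < length vs" "r s" "r s'"
    "d (map r [0..<Suc s]) = Some u" "d (map r [0..<Suc s']) = Some u" for s s' u
  proof -
    have "(vs ! s, u) \<in> algo_matching vs d r s'" unfolding algo_matching_def using that by blast
    then have "u \<in> snd ` algo_matching vs d r s'" by force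
    then show False using assms that(2,4,6) unfolding valid_algo_def by blast
  qed
  show ?thesis
  proof (rule inj_onI)
    fix e e' assume "e \<in> algo_matching vs d r (length vs)" "e' \<in> algo_matching vs d r (length vs)"
      and eq: "snd e = snd e'"
    then obtain s s' where s: "s < length vs" "r s" "fst e = vs ! s" "d (map r [0..<Suc s]) = Some (snd e)"
      and s': "s' < length vs" "r s'" "fst e' = vs ! s'" "d (map r [0..<Suc s']) = Some (snd e')"
      by (metis algo_matching_cases)
    then have "s = s'" using late[of s s'] late[of s' s] eq by (metis nat_neq_iff)
    then show "e = e'" using s s' eq by (simp add: prod_eq_iff)
  qed
qed

lemma sum_of_bool_mem: "finite X \<Longrightarrow> (\<Sum>e\<in>X. of_bool (e \<in> M)) = real (card (X \<inter> M))"
  by (simp add: of_bool_def sum.If_cases Int_def)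

lemma card_inter_le_1:
  assumes "inj_on f M" "\<And>e. e \<in> X \<Longrightarrow> f e = c" "finite X"
  shows "card (X \<inter> M) \<le> 1"
proof -
  have "card (X \<inter> M) = card (f ` (X \<inter> M))"
    using assms(1) by (intro card_image[symmetric]) (auto intro: inj_on_subset)
  also have "\<dots> \<le> card {c}" using assms(2) by (intro card_mono) auto
  finally show ?thesis by simp
qed

text \<open>The witness gives each edge its probability of being matched. The first two constraints
  hold because each realization yields a matching supported on realized vertices; the third rests on
  the independence of the arrival at \<open>t\<close> from the earlier matching.\<close>

lemma valid_algo_LP_solution:
  assumes inst: "vertex_arrival_instance A B E w p vs" and d: "valid_algo E vs d"
  shows "\<exists>y. LP_V_feasible A B E p vs y \<and>
    measure_pmf.expectation (realizations p vs) (\<lambda>r. sum w (algo_matching vs d r (length vs)))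
      = (\<Sum>e\<in>E. w e * y e)"
proof -
  have finE: "finite E"
    using inst unfolding vertex_arrival_instance_def by (meson finite_SigmaI finite_subset)
  have edge: "fst e \<in> A" if "e \<in> E" for e
    using inst that unfolding vertex_arrival_instance_def by auto
  have p: "0 \<le> p v" "p v \<le> 1" if "v \<in> A" for v
    using inst that unfolding vertex_arrival_instance_def by auto
  have vs: "set vs = A" "distinct vs"
    using inst unfolding vertex_arrival_instance_def by auto
  let ?n = "length vs"
  define R where "R = realizations p vs"
  define Mt where "Mt = (\<lambda>r t. algo_matching vs d r t)"
  define y where "y = (\<lambda>e. measure_pmf.expectation R (\<lambda>r. of_bool (e \<in> Mt r ?n) :: real))"
  have finR: "finite (set_pmf R)"
    unfolding R_def realizations_def by (simp add: set_Pi_pmf finite_PiE_dflt)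
  note int = integrable_finite_pmf[OF finR]
  have sum_y: "(\<Sum>e\<in>X. y e) = measure_pmf.expectation R (\<lambda>r. real (card (X \<inter> Mt r ?n)))"
    if "finite X" for X
    unfolding y_def sum_of_bool_mem[OF that, symmetric] using int
    by (simp add: Bochner_Integration.integral_sum)
  have MtE: "Mt r ?n \<subseteq> E" for r unfolding Mt_def by (rule algo_matching_subset[OF d])
  have inj: "inj_on snd (Mt r ?n)" for r unfolding Mt_def by (rule inj_on_snd_algo_matching[OF d])
  have pt: "0 \<le> p (vs ! t)" "p (vs ! t) \<le> 1" if "t < ?n" for t
    using p vs that by auto
  have real_t: "measure_pmf.expectation R (\<lambda>r. of_bool (r t)) = p (vs ! t)" if "t < ?n" for t
    using realization_independent[of t vs p "\<lambda>_. 1"] pt[OF that] that by (simp add: R_def)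
  have Mt_iff: "(vs ! s, u) \<in> Mt r t \<longleftrightarrow> s < t \<and> r s \<and> d (map r [0..<Suc s]) = Some u"
    if "t \<le> ?n" "s < ?n" for s u r t
    unfolding Mt_def by (rule algo_matching_iff[OF vs(2) that])
  have "LP_V_feasible A B E p vs y"
    unfolding LP_V_feasible_def
  proof (intro conjI ballI)
    fix v assume "v \<in> A"
    then obtain t where t: "t < ?n" "v = vs ! t" using vs by (metis in_set_conv_nth)
    let ?X = "{e \<in> E. fst e = v}"
    have "(\<Sum>e\<in>?X. y e) = measure_pmf.expectation R (\<lambda>r. real (card (?X \<inter> Mt r ?n)))"
      using finE by (intro sum_y) simp
    also have "\<dots> \<le> measure_pmf.expectation R (\<lambda>r. of_bool (r t))"
    proof (rule expectation_mono_finite[OF finR])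
      fix r
      \<comment> \<open>If the decision is \<open>None\<close>, the singleton holds a junk edge,
        which is harmless as only its cardinality is used.\<close>
      have X: "?X \<inter> Mt r ?n \<subseteq> (if r t then {(v, the (d (map r [0..<Suc t])))} else {})"
        using t by (auto simp: Mt_iff)
      have "card (?X \<inter> Mt r ?n) \<le> card (if r t then {(v, the (d (map r [0..<Suc t])))} else {})"
        by (rule card_mono[OF _ X]) simp
      then show "real (card (?X \<inter> Mt r ?n)) \<le> of_bool (r t)" by (auto split: if_splits)
    qed
    also have "\<dots> = p v" using real_t t by simp
    finally show "(\<Sum>e\<in>?X. y e) \<le> p v" .
  next
    fix u assume "u \<in> B"
    let ?X = "{e \<in> E. snd e = u}"
    have "(\<Sum>e\<in>?X. y e) = measure_pmf.expectation R (\<lambda>r. real (card (?X \<inter> Mt r ?n)))"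
      using finE by (intro sum_y) simp
    also have "\<dots> \<le> measure_pmf.expectation R (\<lambda>_. 1)"
      using card_inter_le_1[OF inj, of ?X u] finE by (intro expectation_mono_finite[OF finR]) auto
    finally show "(\<Sum>e\<in>?X. y e) \<le> 1" by simp
  next
    fix e assume e: "e \<in> E"
    then obtain t where t: "t < ?n" "fst e = vs ! t" using edge vs by (metis in_set_conv_nth)
    define u where "u = snd e"
    have e': "e = (vs ! t, u)" using t by (simp add: u_def prod_eq_iff)
    let ?X = "{e' \<in> E. edge_before vs e' e}"
    define free where "free = (\<lambda>r. of_bool (u \<notin> snd ` Mt r t) :: real)"
    \<comment> \<open>Matching \<open>e\<close> requires that \<open>vs ! t\<close> arrives and that
      \<open>u\<close> is free just before time \<open>t\<close>.\<close>
    have "y e \<le> measure_pmf.expectation R (\<lambda>r. of_bool (r t) * free r)"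
      unfolding y_def
    proof (rule expectation_mono_finite[OF finR])
      fix r
      have "r t \<and> u \<notin> snd ` Mt r t" if "e \<in> Mt r ?n"
      proof -
        have "r t" "d (map r [0..<Suc t]) = Some u" using that t e' by (auto simp: Mt_iff)
        then show ?thesis using d t unfolding valid_algo_def Mt_def by blast
      qed
      then show "of_bool (e \<in> Mt r ?n) \<le> of_bool (r t) * free r" by (auto simp: free_def)
    qed
    also have "\<dots> = p (fst e) * measure_pmf.expectation R free"
      unfolding R_def t(2) using pt t
      by (intro realization_independent) (simp_all add: free_def Mt_def algo_matching_upd)
    also have "\<dots> \<le> p (fst e) * (1 - alpha E vs y e)"
    proof (rule mult_left_mono)
      have "measure_pmf.expectation R free
          \<le> measure_pmf.expectation R (\<lambda>r. 1 - real (card (?X \<inter> Mt r ?n)))"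
      proof (rule expectation_mono_finite[OF finR])
        fix r
        have "card (?X \<inter> Mt r ?n) \<le> 1"
          using finE by (intro card_inter_le_1[OF inj, of _ u]) (auto simp: edge_before_def u_def)
        \<comment> \<open>Edges at \<open>u\<close> preceding \<open>e\<close> can be matched only
          before time \<open>t\<close>, so one of them in the final matching would already occupy
          \<open>u\<close>.\<close>
        moreover have "?X \<inter> Mt r ?n = {}" if "u \<notin> snd ` Mt r t"
        proof (rule ccontr)
          assume "?X \<inter> Mt r ?n \<noteq> {}"
          then obtain e1 where e1: "edge_before vs e1 e" "e1 \<in> Mt r ?n" by auto
          then obtain i j where "i < j" "j < ?n" "fst e1 = vs ! i" "fst e = vs ! j" "snd e1 = u"
            unfolding edge_before_def u_def by auto
          moreover from this have "j = t" using t vs(2) by (simp add: nth_eq_iff_index_eq)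
          ultimately have "e1 \<in> Mt r t"
            using e1(2) t Mt_iff[of ?n i u r] Mt_iff[of t i u r] by (cases e1) auto
          then show False using that \<open>snd e1 = u\<close> by force
        qed
        ultimately show "free r \<le> 1 - real (card (?X \<inter> Mt r ?n))"
          unfolding free_def by auto
      qed
      also have "\<dots> = 1 - alpha E vs y e"
        unfolding alpha_def using sum_y[of ?X] finE int by simp
      finally show "measure_pmf.expectation R free \<le> 1 - alpha E vs y e" .
    qed (use p edge e in auto)
    finally show "y e \<le> p (fst e) * (1 - alpha E vs y e)" .
  next
    fix e assume "e \<in> E"
    show "0 \<le> y e" unfolding y_def by (intro integral_nonneg_AE) auto
  qed
  moreover have "measure_pmf.expectation R (\<lambda>r. sum w (Mt r ?n)) = (\<Sum>e\<in>E. w e * y e)"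
  proof -
    have "sum w (Mt r ?n) = (\<Sum>e\<in>E. w e * of_bool (e \<in> Mt r ?n))" for r
    proof -
      have "(\<Sum>e\<in>E. w e * of_bool (e \<in> Mt r ?n)) = (\<Sum>e\<in>Mt r ?n. w e * of_bool (e \<in> Mt r ?n))"
        using finE MtE by (intro sum.mono_neutral_right) auto
      then show ?thesis by simp
    qed
    then show ?thesis
      unfolding y_def using int by (simp add: Bochner_Integration.integral_sum)
  qed
  ultimately show ?thesis unfolding R_def Mt_def by blast
qed

text \<open>A randomized algorithm averages over deterministic ones, each of which has an LP point
  of the same value.\<close>

lemma OPT_le_LP_V:
  assumes inst: "vertex_arrival_instance A B E w p vs" and opt: "LP_V_optimal A B E w p vs x"
  shows "OPT E w p vs \<le> (\<Sum>e\<in>E. w e * x e)"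
proof -
  let ?L = "\<Sum>e\<in>E. w e * x e"
  define R where "R = realizations p vs"
  define h where "h = (\<lambda>d r. sum w (algo_matching vs d r (length vs)))"
  have finR: "finite (set_pmf R)"
    unfolding R_def realizations_def by (simp add: set_Pi_pmf finite_PiE_dflt)
  obtain D where D: "D \<in> online_algos E vs" "algo_value w p vs D = OPT E w p vs"
    using OPT_is_maximum(1)[OF inst] by blast
  have valid: "valid_algo E vs d" if "d \<in> set_pmf D" for d
    using D(1) that unfolding online_algos_def by blast
  have h0: "0 \<le> h d r" if "d \<in> set_pmf D" for d r
    unfolding h_def using inst algo_matching_subset[OF valid[OF that]]
    unfolding vertex_arrival_instance_def by (intro sum_nonneg) auto
  have le: "measure_pmf.expectation R (h d) \<le> ?L" if "d \<in> set_pmf D" for d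
    using valid_algo_LP_solution[OF inst valid[OF that]] opt
    unfolding LP_V_optimal_def R_def h_def by auto
  have L0: "0 \<le> ?L"
    using inst opt unfolding LP_V_optimal_def LP_V_feasible_def vertex_arrival_instance_def
    by (intro sum_nonneg) auto
  \<comment> \<open>\<open>D\<close> may have infinite support; passing to non-negative integrals
    allows iterated integration without integrability conditions.\<close>
  have "OPT E w p vs = enn2real (\<integral>\<^sup>+z. ennreal (h (fst z) (snd z)) \<partial>pair_pmf D R)"
    unfolding D(2)[symmetric] algo_value_def R_def[symmetric] case_prod_unfold h_def[symmetric] using h0
    by (intro integral_eq_nn_integral) (auto simp: AE_measure_pmf_iff)
  also have "\<dots> = enn2real (\<integral>\<^sup>+d. \<integral>\<^sup>+r. ennreal (h d r) \<partial>R \<partial>D)"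
    by (simp add: nn_integral_pair_pmf')
  also have "\<dots> \<le> ?L"
  proof (rule enn2real_leI[OF L0])
    have "(\<integral>\<^sup>+r. ennreal (h d r) \<partial>R) \<le> ennreal ?L" if "d \<in> set_pmf D" for d
    proof -
      have "(\<integral>\<^sup>+r. ennreal (h d r) \<partial>R) = ennreal (measure_pmf.expectation R (h d))"
        using h0[OF that] finR by (intro nn_integral_eq_integral integrable_measure_pmf_finite) auto
      then show ?thesis using le[OF that] by (simp add: ennreal_leI)
    qed
    then have "(\<integral>\<^sup>+d. \<integral>\<^sup>+r. ennreal (h d r) \<partial>R \<partial>D) \<le> (\<integral>\<^sup>+d. ennreal ?L \<partial>D)"
      by (intro nn_integral_mono_AE) (auto simp: AE_measure_pmf_iff)
    then show "(\<integral>\<^sup>+d. \<integral>\<^sup>+r. ennreal (h d r) \<partial>R \<partial>D) \<le> ennreal ?L" by simp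
  qed
  finally show ?thesis .
qed

theorem theorem1:
  fixes A :: "'a set" and B :: "'b set" and E :: "('a \<times> 'b) set"
    and w :: "'a \<times> 'b \<Rightarrow> real" and p :: "'a \<Rightarrow> real" and vs :: "'a list"
    and x :: "'a \<times> 'b \<Rightarrow> real"
    and pick :: "('a \<times> 'b) set \<Rightarrow> ('a \<times> 'b) set \<Rightarrow> ('a \<times> 'b) pmf"
  assumes "vertex_arrival_instance A B E w p vs"
    and "LP_V_optimal A B E w p vs x"
    and "max_weight_rule E w pick"
  shows "measure_pmf.expectation (vertex_rounding E p vs x pick) (\<lambda>M. \<Sum>e\<in>M. w e)
           = (\<Sum>v\<in>A. measure_pmf.expectation (vertex_rounding E p vs x pick) (\<lambda>M. WM w M v))
         \<and> (\<Sum>v\<in>A. measure_pmf.expectation (vertex_rounding E p vs x pick) (\<lambda>M. WM w M v))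
           \<ge> (1 - 1 / exp 1) * OPT E w p vs"
proof -
  interpret vertex_arrival_rounding A B E w p vs x pick
    using assms unfolding LP_V_optimal_def by unfold_locales auto
  \<comment> \<open>Optimality of \<open>x\<close> makes its LP value an upper bound for
    \<open>OPT\<close>.\<close>
  have "(1 - 1 / exp 1) * OPT E w p vs \<le> (1 - 1 / exp 1) * (\<Sum>e\<in>E. w e * x e)"
    using OPT_le_LP_V[OF assms(1,2)] by (intro mult_left_mono) auto
  then show ?thesis
    using expectation_rounding_weight_ge expectation_rounding_eq_sum_WM by linarith
qed

end
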